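(* For integers $k,n\ge1$ let $m_{k,n}$ be the Lebesgue measure of the set of those $x\in[0,1]$ whose continued fraction expansion up to the $n$-th digit does not contain a block of $k$ consecutive digits $1$. For each $k$ let $\lambda_k$ be the exponential decay rate of $m_{k,n}$ as $n\to\infty$, i.e. $\lambda_k=\lim_{n\to\infty}m_{k,n}^{1/n}$, and let $z=\frac{\sqrt5-1}2$. Then $$\lim_{k\to\infty}\frac{1-\lambda_k}{z^{2k}}=\frac{z^3(1+z^2)^2}{\ln2}.$$
   Context: The continued fraction expansion of an irrational $x\in(0,1)$ is $x=1/(a_1+1/(a_2+\cdots))$ with digits $a_i\in\{1,2,\dots\}$, generated by the Gauss map $x\mapsto \frac1x \bmod 1$; rational points have Lebesgue measure zero and may be ignored. The paper's phrase is that, for each $k$, the numbers $m_{k,n}$ decrease asymptotically like $\lambda_k^n$ as $n\to\infty$. *)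

theory Defs
  imports "HOL-Analysis.Analysis"
begin

definition gauss_map :: "real \<Rightarrow> real" where
  "gauss_map x = frac (1 / x)"

text \<open>
  Digits are indexed from 1, so \<open>cf_digit 1 x = \<lfloor>1 / x\<rfloor>\<close>. Only irrational \<open>x\<close> in the
  unit interval are of interest: there no iterate of the Gauss map vanishes.
\<close>

definition cf_digit :: "nat \<Rightarrow> real \<Rightarrow> int" where
  "cf_digit i x = \<lfloor>1 / (gauss_map ^^ (i - 1)) x\<rfloor>"

definition has_ones_block :: "nat \<Rightarrow> nat \<Rightarrow> real \<Rightarrow> bool" where
  "has_ones_block k n x \<longleftrightarrow>
     (\<exists>i\<ge>1. i + k \<le> n + 1 \<and> (\<forall>j\<in>{i..<i + k}. cf_digit j x = 1))"

text \<open>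
  The rationals, which have no infinite expansion, form a null set and are removed.
\<close>

definition no_ones_block_set :: "nat \<Rightarrow> nat \<Rightarrow> real set" where
  "no_ones_block_set k n = {x \<in> {0..1} - \<rat>. \<not> has_ones_block k n x}"

definition ones_free_measure :: "nat \<Rightarrow> nat \<Rightarrow> real" where
  "ones_free_measure k n = measure lebesgue (no_ones_block_set k n)"

text \<open>
  \<open>lim\<close> is unspecified on divergent sequences, so statements about \<open>decay_rate k\<close> are
  meaningful only together with convergence of the sequence below.
\<close>

definition decay_rate :: "nat \<Rightarrow> real" where
  "decay_rate k = lim (\<lambda>n. root n (ones_free_measure k n))"

end

theory Submission
  imports Defs "HOL-Number_Theory.Fib"
begin

text \<open>
  Let \<open>P n\<close> be the Gauss measure of the set of points without a block of \<open>k\<close> digits 1 among the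
  first \<open>n\<close> digits (\<open>survival\<close>). As the Gauss map \<open>T\<close> preserves this measure, \<open>P n - P (n + 1)\<close>
  is the measure of the points that start with \<open>k\<close> digits 1 and have no block among the digits
  2 to \<open>n + 1\<close>. Such a point consists of \<open>k\<close> digits 1, a digit other than 1, and a point without
  a block among its first \<open>n - k\<close> digits (\<open>first_block_removal\<close>). If the three parts were
  independent, then \<open>P n - P (n + 1)\<close> would be \<open>P (n - k)\<close> times the measure \<open>e\<close> of the set where
  digits 1 to \<open>k\<close> are 1 and the next one is not, and \<open>1 - \<lambda>\<^sub>k\<close> would be asymptotic to \<open>e\<close>.
  The cylinder of \<open>k\<close> digits 1 has length \<open>1 / (F\<^sub>k\<^sub>+\<^sub>1 F\<^sub>k\<^sub>+\<^sub>2)\<close>, asymptotic to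
  \<open>5 z ^ (2 * k + 3)\<close>; it shrinks to \<open>z\<close>, where the Gauss density is
  \<open>1 / ((1 + z) ln 2) = z / ln 2\<close>; and the following digit is 1 with limiting probability
  \<open>1 / (2 + z) = z\<^sup>2 = 1 - z\<close>. This gives \<open>5 z\<^sup>5 / ln 2\<close> after division by \<open>z ^ (2 * k)\<close>,
  which is the constant of the theorem because \<open>1 + z\<^sup>2 = z sqrt 5\<close> (\<open>rate_constant\<close>).

  Independence holds up to a relative error that tends to 0 with \<open>k\<close>. Given a past, the future has a
  density \<open>(1 + a) / (1 + a y)\<^sup>2\<close> with a parameter \<open>a\<close> (\<open>nu\<close>), and reading a digit \<open>d\<close>
  changes \<open>a\<close> to \<open>1 / (d + a)\<close>. The resulting averaging operator contracts Lipschitz constants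
  (\<open>averaging_contraction\<close>), and the Gauss measure is a mixture of the laws \<open>nu a\<close>
  (\<open>mu_mixture_eq\<close>), so \<open>nu a\<close> and the Gauss measure agree on preimages under \<open>T ^ m\<close> up to an
  error exponentially small in \<open>m\<close>, relative to the measure of the set (\<open>nu_pre_mu\<close>). To make room
  for \<open>m = k\<close> digits, blocks in a window of \<open>2 k\<close> digits are ignored. This is harmless: a crude
  version of the one-step identity shows that \<open>P\<close> changes over such a window only by a factor
  tending to 1 (\<open>survival_Suc_ge\<close>), because \<open>k z ^ (2 * k)\<close> tends to 0. Hence
  \<open>1 - P (n + 1) / P n\<close> lies, for all \<open>n \<ge> 2 k\<close>, between two rates with the same asymptotics
  (\<open>survival_ratio_bounds\<close>, \<open>rates_limit\<close>), and so does \<open>1 - \<lambda>\<^sub>k\<close>.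

  For every \<open>k\<close>, the limit defining \<open>\<lambda>\<^sub>k\<close> exists by Fekete's lemma, since the densities of the laws
  \<open>nu a\<close> are at most 2 and therefore \<open>m\<^sub>k\<^sub>,\<^sub>n\<^sub>+\<^sub>j \<le> 2 m\<^sub>k\<^sub>,\<^sub>n m\<^sub>k\<^sub>,\<^sub>j\<close>
  (\<open>ones_free_measure_submult\<close>).
\<close>

section \<open>The Gauss map and its inverse branches\<close>

definition irr :: "real set" where
  "irr = {0..1} - \<rat>"

definition pre :: "real set \<Rightarrow> real set" where
  "pre B = {x \<in> irr. gauss_map x \<in> B}"

definition branch :: "nat \<Rightarrow> real set \<Rightarrow> real set" where
  "branch d B = (\<lambda>y. 1 / (real d + y)) ` B"

lemma irr_bounds: "x \<in> irr \<Longrightarrow> 0 < x \<and> x < 1"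
proof -
  assume x: "x \<in> irr"
  then have "x \<noteq> 0" "x \<noteq> 1" by (auto simp: irr_def)
  with x show ?thesis by (auto simp: irr_def)
qed

lemma Rats_inverse_iff: "1 / x \<in> \<rat> \<longleftrightarrow> (x::real) \<in> \<rat>"
  using Rats_inverse[of x] Rats_inverse[of "1 / x"] by (auto simp only: inverse_eq_divide div_by_1 divide_divide_eq_right mult_1)

lemma Rats_add_nat_iff: "real d + x \<in> \<rat> \<longleftrightarrow> x \<in> \<rat>"
  using Rats_diff[of "real d + x" "real d"] by auto

lemma inverse_branch:
  assumes "1 \<le> d" "y \<in> irr"
  shows "1 / (real d + y) \<in> irr" "\<lfloor>1 / (1 / (real d + y))\<rfloor> = int d"
    "gauss_map (1 / (real d + y)) = y"
proof -
  have y: "0 < y" "y < 1" using irr_bounds assms by auto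
  have d: "real d \<ge> 1" using assms by simp
  have "1 / (real d + y) \<notin> \<rat>"
    using assms by (simp only: Rats_inverse_iff Rats_add_nat_iff) (simp add: irr_def)
  then show "1 / (real d + y) \<in> irr" using y d by (auto simp: irr_def field_simps)
  have fl: "\<lfloor>real d + y\<rfloor> = int d" using y by (simp add: floor_eq_iff)
  have inv: "1 / (1 / (real d + y)) = real d + y" by simp
  show "\<lfloor>1 / (1 / (real d + y))\<rfloor> = int d" by (simp only: inv fl)
  show "gauss_map (1 / (real d + y)) = y" by (simp only: inv gauss_map_def frac_def fl)
qed

lemma gauss_map_irr:
  assumes "x \<in> irr"
  shows "gauss_map x \<in> irr" "1 \<le> \<lfloor>1 / x\<rfloor>" "x = 1 / (of_int \<lfloor>1 / x\<rfloor> + gauss_map x)"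
proof -
  have x: "0 < x" "x < 1" using irr_bounds assms by auto
  show "1 \<le> \<lfloor>1 / x\<rfloor>" using x by (simp add: le_floor_iff)
  have "1 / x \<notin> \<rat>" using assms by (simp add: Rats_inverse_iff irr_def)
  then have "frac (1 / x) \<notin> \<rat>" using Rats_add[of "frac (1/x)" "of_int \<lfloor>1/x\<rfloor>"]
    by (auto simp: frac_def)
  then show "gauss_map x \<in> irr"
    using frac_ge_0[of "1/x"] frac_lt_1[of "1/x"] by (auto simp: irr_def gauss_map_def)
  show "x = 1 / (of_int \<lfloor>1 / x\<rfloor> + gauss_map x)" by (simp add: gauss_map_def frac_def)
qed

lemma branch_eq:
  assumes "1 \<le> d" "B \<subseteq> irr"
  shows "branch d B = {x \<in> irr. \<lfloor>1 / x\<rfloor> = int d \<and> gauss_map x \<in> B}"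
proof (intro set_eqI iffI)
  fix x assume "x \<in> branch d B"
  then obtain y where "y \<in> B" "x = 1 / (real d + y)" by (auto simp: branch_def)
  then show "x \<in> {x \<in> irr. \<lfloor>1 / x\<rfloor> = int d \<and> gauss_map x \<in> B}"
    using inverse_branch[OF assms(1), of y] assms(2) by auto
next
  fix x assume x: "x \<in> {x \<in> irr. \<lfloor>1 / x\<rfloor> = int d \<and> gauss_map x \<in> B}"
  then have "x = 1 / (real d + gauss_map x)" using gauss_map_irr(3)[of x] by simp
  with x show "x \<in> branch d B" unfolding branch_def by blast
qed

lemma pre_eq_UN_branch:
  assumes "B \<subseteq> irr"
  shows "pre B = (\<Union>n. branch (Suc n) B)"
proof -
  have "\<exists>n. \<lfloor>1 / x\<rfloor> = int (Suc n)" if "x \<in> irr" for x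
    using gauss_map_irr(2)[OF that] by (intro exI[of _ "nat \<lfloor>1 / x\<rfloor> - 1"]) linarith
  then show ?thesis using branch_eq[OF _ assms] by (auto simp: pre_def)
qed

lemma disjoint_branches:
  assumes "\<And>n. B n \<subseteq> irr"
  shows "disjoint_family (\<lambda>n. branch (Suc n) (B n))"
  using branch_eq[OF _ assms] by (auto simp: disjoint_family_on_def)

lemma irr_borel [measurable]: "irr \<in> sets borel"
proof -
  have "(\<rat> :: real set) \<in> sets borel" by (rule sets.countable[OF _ countable_rat]) simp
  then show ?thesis by (simp add: irr_def)
qed

lemma gauss_map_measurable [measurable]: "gauss_map \<in> borel_measurable borel"
  unfolding gauss_map_def[abs_def] frac_def by measurable

lemma pre_borel: "B \<in> sets borel \<Longrightarrow> pre B \<in> sets borel"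
proof -
  assume B [measurable]: "B \<in> sets borel"
  have "{x \<in> space borel. x \<in> irr \<and> gauss_map x \<in> B} \<in> sets borel" by measurable
  then show ?thesis by (simp add: pre_def)
qed

lemma branch_borel:
  assumes "1 \<le> d" "B \<subseteq> irr" "B \<in> sets borel"
  shows "branch d B \<in> sets borel"
proof -
  note [measurable] = assms(3)
  have "{x \<in> space borel. x \<in> irr \<and> \<lfloor>1 / x\<rfloor> = int d \<and> gauss_map x \<in> B} \<in> sets borel" by measurable
  then show ?thesis by (simp add: branch_eq[OF assms(1,2)])
qed

lemma branch_subset: "1 \<le> d \<Longrightarrow> B \<subseteq> irr \<Longrightarrow> branch d B \<subseteq> irr"
  by (auto simp: branch_eq)

lemma pre_subset: "pre B \<subseteq> irr"
  by (auto simp: pre_def)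

section \<open>Measures with a density on the unit interval\<close>

text \<open>
  The indicator makes the measure live on the unit interval, so that conditions on \<open>h\<close> concern only this interval.
\<close>
definition weighted :: "(real \<Rightarrow> real) \<Rightarrow> real measure" where
  "weighted h = density lborel (\<lambda>x. ennreal (indicator {0..1} x * h x))"

definition weight :: "(real \<Rightarrow> real) \<Rightarrow> bool" where
  "weight h \<longleftrightarrow> continuous_on {0..1} h \<and> (\<forall>x\<in>{0..1}. 0 \<le> h x)"

lemma sets_weighted [simp, measurable_cong]: "sets (weighted h) = sets borel"
  by (simp add: weighted_def)

lemma weight_absolutely_integrable:
  assumes "weight h" "B \<in> sets borel" "B \<subseteq> {0..1}"
  shows "set_integrable lborel B h"
proof -
  have "set_integrable lborel {0..1} h"
    unfolding set_integrable_def using assms(1)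
    by (intro borel_integrable_compact) (auto simp: weight_def)
  then show ?thesis by (rule set_integrable_subset) (use assms in auto)
qed

lemma weighted_integral:
  assumes "weight h" "B \<in> sets borel" "B \<subseteq> {0..1}"
  shows "emeasure (weighted h) B = ennreal (integral B h)" "0 \<le> integral B h"
    "measure (weighted h) B = integral B h" "h integrable_on B"
proof -
  let ?h = "\<lambda>x. indicator {0..1} x * h x"
  have hm: "?h \<in> borel_measurable lborel"
    using weight_absolutely_integrable[OF assms(1), of "{0..1}"]
    by (simp add: set_integrable_def integrable_iff_bounded)
  have int: "set_integrable lborel B h" by (rule weight_absolutely_integrable[OF assms])
  have nn: "0 \<le> h x" if "x \<in> B" for x using that assms by (auto simp: weight_def)
  have "emeasure (weighted h) B = (\<integral>\<^sup>+x. ennreal (?h x) * indicator B x \<partial>lborel)"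
    unfolding weighted_def using hm assms by (subst emeasure_density) auto
  also have "\<dots> = (\<integral>\<^sup>+x. ennreal (indicator B x *\<^sub>R h x) \<partial>lborel)"
    using assms(3) by (intro nn_integral_cong) (auto simp: indicator_def)
  also have "\<dots> = ennreal (LINT x:B|lborel. h x)"
    unfolding set_lebesgue_integral_def using int nn
    by (intro nn_integral_eq_integral) (auto simp: set_integrable_def indicator_def)
  also have eq: "(LINT x:B|lborel. h x) = integral B h"
    using set_borel_integral_eq_integral(2)[OF int] .
  finally show em: "emeasure (weighted h) B = ennreal (integral B h)" .
  show "h integrable_on B" using set_borel_integral_eq_integral(1)[OF int] .
  show nn: "0 \<le> integral B h" unfolding eq[symmetric] set_lebesgue_integral_def
    using nn by (intro integral_nonneg_AE) (auto simp: indicator_def)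
  show "measure (weighted h) B = integral B h" using em nn by (simp add: measure_def)
qed

lemma finite_measure_weighted: "weight h \<Longrightarrow> finite_measure (weighted h)"
proof (rule finite_measureI)
  assume h: "weight h"
  have hm: "(\<lambda>x. indicator {0..1} x * h x) \<in> borel_measurable lborel"
    using weight_absolutely_integrable[OF h, of "{0..1}"]
    by (simp add: set_integrable_def integrable_iff_bounded)
  have "emeasure (weighted h) (space (weighted h)) = emeasure (weighted h) {0..1}"
    unfolding weighted_def using hm
    by (simp add: emeasure_density) (intro nn_integral_cong, auto simp: indicator_def)
  then show "emeasure (weighted h) (space (weighted h)) \<noteq> \<infinity>"
    using weighted_integral(1)[OF h, of "{0..1}"] by simp
qed

lemma weighted_le:
  assumes "weight h" "weight g" "B \<in> sets borel" "B \<subseteq> {0..1}" "\<And>x. x \<in> B \<Longrightarrow> h x \<le> c * g x"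
  shows "measure (weighted h) B \<le> c * measure (weighted g) B"
proof -
  have "integral B h \<le> integral B (\<lambda>x. c * g x)"
    using assms(5) weighted_integral(4)[OF assms(1,3,4)] weighted_integral(4)[OF assms(2,3,4)]
    by (intro integral_le) (auto intro: integrable_on_cmult_iff[THEN iffD2] integrable_on_mult_right)
  also have "\<dots> = c * integral B g" by simp
  finally show ?thesis
    using weighted_integral(3)[OF assms(1,3,4)] weighted_integral(3)[OF assms(2,3,4)] by simp
qed

text \<open>
  Change of variables along one inverse branch. Every identity about the Gauss map below is this
  one, applied to a particular density.
\<close>
lemma weighted_branch:
  assumes h: "weight h" and d: "1 \<le> d" and B: "B \<subseteq> irr" "B \<in> sets borel"
  shows "measure (weighted h) (branch d B) = integral B (\<lambda>y. h (1 / (real d + y)) / (real d + y)\<^sup>2)"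
proof -
  let ?g = "\<lambda>y. 1 / (real d + y)"
  have BI: "B \<subseteq> {0..1}" using B by (auto simp: irr_def)
  have BL: "B \<in> sets lebesgue" using B(2) sets_completionI_sets by (metis sets_lborel)
  have bI: "branch d B \<subseteq> {0..1}" using branch_subset[OF d B(1)] by (auto simp: irr_def)
  have bB: "branch d B \<in> sets borel" by (rule branch_borel[OF d B])
  have pos: "0 < real d + y" if "y \<in> B" for y using that BI d by force
  have "h absolutely_integrable_on branch d B"
    using weight_absolutely_integrable[OF h bB bI] bB
    by (simp add: set_integrable_def integrable_completion)
  then have 1: "h absolutely_integrable_on ?g ` B \<and> integral (?g ` B) h = integral (branch d B) h"
    by (simp add: branch_def)
  have "inj_on ?g B" using pos by (auto simp: inj_on_def)
  moreover have "(?g has_field_derivative (- 1 / (real d + y)\<^sup>2)) (at y within B)" if "y \<in> B" for y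
    using pos[OF that] by (auto intro!: derivative_eq_intros simp: power2_eq_square)
  ultimately have "integral B (\<lambda>y. \<bar>- 1 / (real d + y)\<^sup>2\<bar> * h (?g y)) = integral (branch d B) h"
    using has_absolute_integral_change_of_variables_1'[OF BL, of ?g "\<lambda>y. - 1 / (real d + y)\<^sup>2" h] 1
    by blast
  then show ?thesis using weighted_integral(3)[OF h bB bI] by (simp add: abs_divide)
qed

lemma weighted_Diff:
  assumes "weight h" "A \<in> sets borel" "B \<in> sets borel" "B \<subseteq> A"
  shows "measure (weighted h) (A - B) = measure (weighted h) A - measure (weighted h) B"
  using finite_measure.finite_measure_Diff[OF finite_measure_weighted[OF assms(1)]] assms by auto

lemma weighted_mono:
  assumes "weight h" "A \<in> sets borel" "B \<subseteq> A"
  shows "measure (weighted h) B \<le> measure (weighted h) A"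
  using finite_measure.finite_measure_mono[OF finite_measure_weighted[OF assms(1)]] assms by auto

lemma weighted_branch_sums:
  assumes "weight h" "\<And>n. B n \<subseteq> irr" "\<And>n. B n \<in> sets borel"
  shows "(\<lambda>n. measure (weighted h) (branch (Suc n) (B n))) sums
    measure (weighted h) (\<Union>n. branch (Suc n) (B n))"
  using branch_borel[OF _ assms(2,3)] disjoint_branches[OF assms(2)]
  by (intro finite_measure.finite_measure_UNION finite_measure_weighted assms) auto

section \<open>Conditional laws and the Gauss measure\<close>

text \<open>
  Let \<open>p/q\<close> and \<open>p'/q'\<close> be the last two convergents of a block of \<open>n\<close> digits, with
  \<open>q' \<le> q\<close>, and put \<open>a = q'/q\<close>. If \<open>x\<close> is distributed uniformly on the cylinder of points that start
  with this block, then the \<open>n\<close>-th iterate of the Gauss map at \<open>x\<close> has density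
  \<open>(1 + a) / (1 + a y)\<^sup>2\<close>. Under Lebesgue measure, the law of the future given any past thus
  has this form; \<open>a = 0\<close> is the empty block, that is, Lebesgue measure.
\<close>
definition cyl_density :: "real \<Rightarrow> real \<Rightarrow> real" where
  "cyl_density a y = (1 + a) / (1 + a * y)\<^sup>2"

definition nu :: "real \<Rightarrow> real set \<Rightarrow> real" where
  "nu a B = measure (weighted (cyl_density a)) B"

definition gauss_density :: "real \<Rightarrow> real" where
  "gauss_density y = 1 / ((1 + y) * ln 2)"

definition mu :: "real set \<Rightarrow> real" where
  "mu B = measure (weighted gauss_density) B"

text \<open>
  The \<open>nu a\<close>-measure of the points with first digit \<open>d\<close>.
\<close>
definition digit_prob :: "nat \<Rightarrow> real \<Rightarrow> real" where
  "digit_prob d a = (1 + a) / ((real d + a) * (real d + 1 + a))"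

lemma weight_cyl_density: "0 \<le> a \<Longrightarrow> weight (cyl_density a)"
proof -
  assume a: "0 \<le> a"
  have "1 + a * x \<noteq> 0" if "x \<in> {0..1}" for x
  proof -
    have "0 \<le> a * x" using that a by simp
    then show ?thesis by linarith
  qed
  then show ?thesis using a
    by (auto simp: weight_def cyl_density_def intro!: continuous_intros)
qed

lemma weight_gauss_density: "weight gauss_density"
  by (auto simp: weight_def gauss_density_def intro!: continuous_intros)

lemma irr_subset: "irr \<subseteq> {0..1}"
  by (auto simp: irr_def)

text \<open>
  The family \<open>nu\<close> is closed under conditioning on the first digit, because appending the digit \<open>d\<close>
  to a block turns \<open>q'/q\<close> into \<open>q/(d q + q') = 1/(d + a)\<close>. Hence \<open>nu\<close> reduces the dynamics to a
  Markov chain in the single parameter \<open>a\<close>.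
\<close>
lemma nu_branch:
  assumes a: "0 \<le> a" and d: "1 \<le> d" and B: "B \<subseteq> irr" "B \<in> sets borel"
  shows "nu a (branch d B) = digit_prob d a * nu (1 / (real d + a)) B"
proof -
  have pt: "cyl_density a (1 / (real d + y)) / (real d + y)\<^sup>2
      = digit_prob d a * cyl_density (1 / (real d + a)) y" if "y \<in> B" for y
  proof -
    have y: "0 < y" using that B irr_bounds by auto
    define D where "D = real d"
    have D: "D \<ge> 1" using d by (simp add: D_def)
    have "1 + a * (1 / (D + y)) = (D + y + a) / (D + y)" using D y by (simp add: field_simps)
    moreover have "1 + 1 / (D + a) * y = (D + y + a) / (D + a)" using D a by (simp add: field_simps)
    moreover have "1 + 1 / (D + a) = (D + 1 + a) / (D + a)" using D a by (simp add: field_simps)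
    ultimately show ?thesis unfolding cyl_density_def digit_prob_def D_def[symmetric]
      using D y a by (simp add: power_divide power2_eq_square)
  qed
  have "nu a (branch d B) = integral B (\<lambda>y. digit_prob d a * cyl_density (1 / (real d + a)) y)"
    unfolding nu_def weighted_branch[OF weight_cyl_density[OF a] d B]
    by (rule integral_cong[OF pt])
  also have "\<dots> = digit_prob d a * integral B (cyl_density (1 / (real d + a)))" by simp
  finally show ?thesis
    unfolding nu_def using weighted_integral(3)[OF weight_cyl_density B(2)] a B irr_subset by auto
qed

lemma nu_branch_sums:
  assumes "0 \<le> a" "\<And>n. B n \<subseteq> irr" "\<And>n. B n \<in> sets borel"
  shows "(\<lambda>n. digit_prob (Suc n) a * nu (1 / (real (Suc n) + a)) (B n)) sums
    nu a (\<Union>n. branch (Suc n) (B n))"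
  using weighted_branch_sums[OF weight_cyl_density, of a B] nu_branch[of a "Suc _" "B _"] assms
  by (simp add: nu_def)

lemma nu_pre_sums:
  assumes "0 \<le> a" "B \<subseteq> irr" "B \<in> sets borel"
  shows "(\<lambda>n. digit_prob (Suc n) a * nu (1 / (real (Suc n) + a)) B) sums nu a (pre B)"
  using nu_branch_sums[of a "\<lambda>_. B"] assms by (simp add: pre_eq_UN_branch)

lemma negligible_Rats: "negligible (\<rat> :: real set)"
  by (simp add: negligible_iff_null_sets null_sets_completionI countable_imp_null_set_lborel countable_rat)

lemma nu_irr:
  assumes a: "0 \<le> a"
  shows "nu a irr = 1"
proof -
  have pos: "1 + a * y > 0" if "y \<in> {0..1}" for y
  proof -
    have "0 \<le> a * y" using that a by simp
    then show ?thesis by linarith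
  qed
  have "nu a irr = integral irr (cyl_density a)"
    using weighted_integral(3)[OF weight_cyl_density irr_borel irr_subset] a by (simp add: nu_def)
  also have "\<dots> = integral {0..1} (cyl_density a)"
    using negligible_Rats by (intro integral_spike_set) (auto simp: irr_def intro: negligible_subset)
  also have "(cyl_density a has_integral ((1 + a) * 1 / (1 + a * 1) - (1 + a) * 0 / (1 + a * 0))) {0..1}"
  proof (rule fundamental_theorem_of_calculus)
    fix y :: real assume "y \<in> {0..1}"
    then have "1 + a * y \<noteq> 0" using pos by fastforce
    then have "((\<lambda>y. (1 + a) * y / (1 + a * y)) has_field_derivative cyl_density a y) (at y within {0..1})"
      unfolding cyl_density_def
      by (auto intro!: derivative_eq_intros simp: power2_eq_square algebra_simps)
    then show "((\<lambda>y. (1 + a) * y / (1 + a * y)) has_vector_derivative cyl_density a y) (at y within {0..1})"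
      by (simp add: has_real_derivative_iff_has_vector_derivative)
  qed simp
  then have "integral {0..1} (cyl_density a) = 1" using a by (simp add: integral_unique)
  finally show ?thesis .
qed

lemma pre_irr: "pre irr = irr"
  using gauss_map_irr by (auto simp: pre_def)

lemma digit_prob_sums:
  assumes "0 \<le> a"
  shows "(\<lambda>n. digit_prob (Suc n) a) sums 1"
  using nu_pre_sums[OF assms order_refl irr_borel] assms by (simp add: nu_irr pre_irr)

text \<open>
  Gauss: summing the pulled back densities \<open>1 / ((d + y) (d + 1 + y))\<close> over the digits telescopes to
  \<open>1 / (1 + y)\<close>. The telescoping is done after integration, where the remainder is at most
  \<open>1 / (n ln 2)\<close>.
\<close>
lemma mu_pre:
  assumes B: "B \<subseteq> irr" "B \<in> sets borel"
  shows "mu (pre B) = mu B"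
proof -
  note BI = order_trans[OF B(1) irr_subset]
  have y: "0 < y" "y < 1" if "y \<in> B" for y using that B irr_bounds by auto
  define g where "g n y = 1 / ((real n + 1 + y) * ln 2)" for n and y :: real
  have wg: "weight (g n)" for n
    by (auto simp: weight_def g_def intro!: continuous_intros)
  have intg: "g n integrable_on B" for n by (rule weighted_integral(4)[OF wg B(2) BI])
  have "measure (weighted gauss_density) (branch (Suc n) B) = integral B (g n) - integral B (g (Suc n))" for n
  proof -
    have "gauss_density (1 / (real (Suc n) + y)) / (real (Suc n) + y)\<^sup>2 = g n y - g (Suc n) y"
      if "y \<in> B" for y
    proof -
      define D where "D = real n + 1 + y"
      have D: "D > 0" "real (Suc n) + y = D" "real (Suc n) + 1 + y = D + 1"
        using y[OF that] by (auto simp: D_def)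
      have "1 + 1 / D = (D + 1) / D" using D by (simp add: field_simps)
      moreover have "ln 2 > (0 :: real)" by simp
      ultimately show ?thesis unfolding gauss_density_def g_def D_def[symmetric] D(2,3)
        using D(1) by (simp add: divide_simps power2_eq_square)
    qed
    then have "integral B (\<lambda>y. gauss_density (1 / (real (Suc n) + y)) / (real (Suc n) + y)\<^sup>2)
        = integral B (\<lambda>y. g n y - g (Suc n) y)" by (rule integral_cong)
    also have "\<dots> = integral B (g n) - integral B (g (Suc n))"
      by (rule integral_diff[OF intg intg])
    finally show ?thesis using weighted_branch[OF weight_gauss_density _ B] by simp
  qed
  then have s1: "(\<lambda>n. integral B (g n) - integral B (g (Suc n))) sums mu (pre B)"
    using weighted_branch_sums[OF weight_gauss_density, of "\<lambda>_. B"] B by (simp add: mu_def pre_eq_UN_branch)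
  have "(\<lambda>n. integral B (g n)) \<longlonglongrightarrow> 0"
  proof (rule tendsto_sandwich[where f = "\<lambda>_. 0" and h = "\<lambda>n. (1 / ln 2) / real (Suc n)"])
    show "\<forall>\<^sub>F n in sequentially. integral B (g n) \<le> (1 / ln 2) / real (Suc n)"
    proof (intro always_eventually allI)
      fix n
      have w1: "weight (\<lambda>_. 1)" by (auto simp: weight_def)
      have "measure (weighted (g n)) B \<le> ((1 / ln 2) / real (Suc n)) * measure (weighted (\<lambda>_. 1)) B"
      proof (intro weighted_le wg w1 B BI)
        fix x assume "x \<in> B"
        then have "(1 / ln 2) / (real n + 1 + x) \<le> (1 / ln 2) / real (Suc n)"
          using y[of x] by (intro divide_left_mono) auto
        then show "g n x \<le> (1 / ln 2) / real (Suc n) * 1"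
          by (simp add: g_def mult.commute)
      qed
      also have "\<dots> \<le> ((1 / ln 2) / real (Suc n)) * 1"
        using weighted_mono[OF w1 irr_borel B(1)] nu_irr[of 0]
        by (intro mult_left_mono) (auto simp: nu_def cyl_density_def[abs_def])
      finally show "integral B (g n) \<le> (1 / ln 2) / real (Suc n)"
        using weighted_integral(3)[OF wg B(2) BI] by simp
    qed
    show "(\<lambda>n. (1 / ln 2) / real (Suc n)) \<longlonglongrightarrow> 0"
      by (intro LIMSEQ_Suc lim_const_over_n)
  qed (use weighted_integral(2)[OF wg B(2) BI] in auto)
  from telescope_sums'[OF this]
  have "(\<lambda>n. integral B (g n) - integral B (g (Suc n))) sums integral B (g 0)" by simp
  with s1 have "mu (pre B) = integral B (g 0)" by (rule sums_unique2)
  also have "\<dots> = mu B"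
    using weighted_integral(3)[OF weight_gauss_density B(2) BI]
    by (simp add: mu_def g_def[abs_def] gauss_density_def[abs_def])
  finally show ?thesis .
qed

section \<open>Loss of memory\<close>

lemma digit_prob_nonneg: "0 \<le> a \<Longrightarrow> 0 \<le> digit_prob d a"
  by (simp add: digit_prob_def)

text \<open>
  From the digit 3 on the digit probabilities increase with the parameter. For the digit 1 they
  decrease and for the digit 2 they do neither, which is why these two digits are treated apart in the
  contraction estimate.
\<close>
lemma digit_prob_diff_nonneg:
  assumes "0 \<le> b" "b \<le> a" "a \<le> 1" "3 \<le> d"
  shows "digit_prob d b \<le> digit_prob d a"
proof -
  define D where "D = real d"
  have D: "D \<ge> 3" using assms by (simp add: D_def)
  have "a * b \<le> 1" using assms by (meson mult_le_one order_trans)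
  moreover have "D * D \<ge> 3 * D" using D by (intro mult_right_mono) auto
  ultimately have "0 \<le> (a - b) * (D * D - D - 1 - (a + b) - a * b)"
    using assms D by (intro mult_nonneg_nonneg) linarith+
  also have "\<dots> = (1 + a) * ((D + b) * (D + 1 + b)) - (1 + b) * ((D + a) * (D + 1 + a))"
    by (simp add: algebra_simps)
  finally have "(1 + b) * ((D + a) * (D + 1 + a)) \<le> (1 + a) * ((D + b) * (D + 1 + b))" by simp
  moreover have "0 < (D + a) * (D + 1 + a)" "0 < (D + b) * (D + 1 + b)" using assms D by auto
  ultimately show ?thesis
    unfolding digit_prob_def D_def[symmetric] by (simp only: pos_divide_le_eq times_divide_eq_left pos_le_divide_eq)
qed

lemma inverse_diff_abs:
  fixes d a b :: real
  assumes "0 < d" "0 \<le> a" "0 \<le> b"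
  shows "\<bar>1 / (d + a) - 1 / (d + b)\<bar> = \<bar>a - b\<bar> / ((d + a) * (d + b))"
proof -
  have "1 / (d + a) - 1 / (d + b) = (b - a) / ((d + a) * (d + b))"
    using assms by (simp add: divide_simps)
  then show ?thesis using assms by (simp add: abs_divide abs_mult abs_minus_commute)
qed

text \<open>
  The averaging operator of the parameter chain contracts Lipschitz constants. Write \<open>p\<^sub>d, x\<^sub>d\<close> and
  \<open>r\<^sub>d, y\<^sub>d\<close> for the probabilities and the images of \<open>a\<close> and \<open>b\<close>. The difference of the
  averages is
  \<open>\<Sum> p\<^sub>d (\<phi> x\<^sub>d - \<phi> y\<^sub>d) + \<Sum> (p\<^sub>d - r\<^sub>d) (\<phi> y\<^sub>d - \<phi> y\<^sub>1)\<close>, since both families of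
  probabilities have sum 1. In the first sum the images are closer than \<open>a\<close> and \<open>b\<close> by a factor
  \<open>1/d\<^sup>2\<close>, and the digit 1 has probability at most \<open>1/2\<close>, which gives \<open>5/8\<close>. In the second sum
  the digit 1 drops out, the digit 2 contributes at most \<open>1/18\<close>, and the digits from 3 on, where all
  differences have one sign, contribute at most \<open>2/9\<close>. The total is \<open>65/72\<close>.
\<close>
lemma averaging_contraction_aux:
  fixes \<phi> :: "real \<Rightarrow> real"
  assumes lip: "\<And>s t. s \<in> {0..1} \<Longrightarrow> t \<in> {0..1} \<Longrightarrow> \<bar>\<phi> s - \<phi> t\<bar> \<le> K * \<bar>s - t\<bar>"
    and ab: "0 \<le> b" "b \<le> a" "a \<le> 1"
    and A: "(\<lambda>n. digit_prob (Suc n) a * \<phi> (1 / (real (Suc n) + a))) sums A"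
    and B: "(\<lambda>n. digit_prob (Suc n) b * \<phi> (1 / (real (Suc n) + b))) sums B"
  shows "\<bar>A - B\<bar> \<le> 65 / 72 * (K * (a - b))"
proof -
  define p where "p n = digit_prob (Suc n) a" for n
  define r where "r n = digit_prob (Suc n) b" for n
  define x where "x n = 1 / (real (Suc n) + a)" for n
  define y where "y n = 1 / (real (Suc n) + b)" for n
  define v where "v n = p n * \<phi> (x n) - r n * \<phi> (y n) - (p n - r n) * \<phi> (y 0)" for n
  have K: "0 \<le> K" using lip[of 0 1] by simp
  have p_sums: "p sums 1" and r_sums: "r sums 1"
    using digit_prob_sums[of a] digit_prob_sums[of b] ab by (simp_all add: p_def[abs_def] r_def[abs_def])
  have p0: "0 \<le> p n" for n using digit_prob_nonneg ab by (simp add: p_def)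
  have xI: "x n \<in> {0..1}" and yI: "y n \<in> {0..1}" for n
    using ab by (auto simp: x_def y_def divide_simps)
  have v_sums: "v sums (A - B - (1 - 1) * \<phi> (y 0))"
    unfolding v_def using A B p_sums r_sums
    by (intro sums_diff sums_mult2) (simp_all add: p_def[abs_def] r_def[abs_def] x_def y_def)
  have split: "v n = p n * (\<phi> (x n) - \<phi> (y n)) + (p n - r n) * (\<phi> (y n) - \<phi> (y 0))" for n
    by (simp add: v_def algebra_simps)
  have lipxy: "\<bar>\<phi> (x n) - \<phi> (y n)\<bar> \<le> K * (a - b) / (real (Suc n))\<^sup>2" for n
  proof -
    have "\<bar>\<phi> (x n) - \<phi> (y n)\<bar> \<le> K * \<bar>x n - y n\<bar>" by (rule lip[OF xI yI])
    also have "\<bar>x n - y n\<bar> = (a - b) / ((real (Suc n) + a) * (real (Suc n) + b))"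
      unfolding x_def y_def using ab by (subst inverse_diff_abs) auto
    also have "\<dots> \<le> (a - b) / (real (Suc n))\<^sup>2"
      unfolding power2_eq_square using ab by (intro divide_left_mono mult_mono) auto
    finally show ?thesis using K by (simp add: mult_left_mono)
  qed
  have lipy0: "\<bar>\<phi> (y n) - \<phi> (y 0)\<bar> \<le> K" for n
  proof -
    have "\<bar>\<phi> (y n) - \<phi> (y 0)\<bar> \<le> K * \<bar>y n - y 0\<bar>" by (rule lip[OF yI yI])
    also have "\<dots> \<le> K * 1" using yI[of n] yI[of 0] K by (intro mult_left_mono) auto
    finally show ?thesis by simp
  qed
  have vn: "\<bar>v n\<bar> \<le> K * (a - b) / 4 * p n + \<bar>p n - r n\<bar> * K" if "n \<ge> 1" for n
  proof -
    have "(real (Suc n))\<^sup>2 \<ge> 2\<^sup>2" using that by (intro power_mono) auto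
    then have "K * (a - b) / (real (Suc n))\<^sup>2 \<le> K * (a - b) / 4"
      using K ab by (intro divide_left_mono) auto
    then have "p n * \<bar>\<phi> (x n) - \<phi> (y n)\<bar> \<le> p n * (K * (a - b) / 4)"
      using order_trans[OF lipxy[of n]] p0[of n] by (intro mult_left_mono) blast+
    moreover have "\<bar>p n - r n\<bar> * \<bar>\<phi> (y n) - \<phi> (y 0)\<bar> \<le> \<bar>p n - r n\<bar> * K"
      using lipy0 by (intro mult_left_mono) auto
    moreover have "\<bar>v n\<bar> \<le> p n * \<bar>\<phi> (x n) - \<phi> (y n)\<bar> + \<bar>p n - r n\<bar> * \<bar>\<phi> (y n) - \<phi> (y 0)\<bar>"
      unfolding split using p0[of n] by (intro order_trans[OF abs_triangle_ineq]) (simp add: abs_mult)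
    ultimately show ?thesis by (simp add: mult.commute)
  qed
  \<comment> \<open>Index 0 is the digit 1, where the second part of the splitting vanishes.\<close>
  have v0: "\<bar>v 0\<bar> \<le> K * (a - b) * p 0"
    using lipxy[of 0] p0[of 0] by (simp add: split abs_mult mult.commute mult_left_mono)
  have p0_val: "p 0 = 1 / (2 + a)" "r 0 = 1 / (2 + b)"
    using ab by (simp_all add: p_def r_def digit_prob_def add_ac)
  have p0_le: "p 0 \<le> 1 / 2" using ab by (simp add: p0_val)
  have abs1: "\<bar>p 1 - r 1\<bar> \<le> (a - b) / 18"
  proof -
    have eq: "p 1 - r 1 = (a - b) * (1 - a - b - a * b) / ((2 + a) * (3 + a) * ((2 + b) * (3 + b)))"
      using ab by (simp add: p_def r_def digit_prob_def divide_simps) (simp add: algebra_simps)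
    have ab1: "0 \<le> a * b" "a * b \<le> 1" using ab mult_mono[of a 1 b 1] by auto
    have "\<bar>1 - a - b - a * b\<bar> \<le> 2" using ab ab1 by linarith
    then have "\<bar>(a - b) * (1 - a - b - a * b)\<bar> \<le> (a - b) * 2"
      unfolding abs_mult using ab by (intro mult_mono) auto
    moreover have "36 \<le> (2 + a) * (3 + a) * ((2 + b) * (3 + b))"
    proof -
      have "(2 * 3) * (2 * 3) \<le> (2 + a) * (3 + a) * ((2 + b) * (3 + b))"
        using ab by (intro mult_mono) auto
      then show ?thesis by simp
    qed
    ultimately have "\<bar>p 1 - r 1\<bar> \<le> (a - b) * 2 / 36"
      unfolding eq abs_divide by (intro frac_le) auto
    then show ?thesis by simp
  qed
  have tail3: "(1 - p 0 - p 1) - (1 - r 0 - r 1) \<le> 2 / 9 * (a - b)"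
  proof -
    have "1 - p 0 - p 1 = (1 + a) / (3 + a)" "1 - r 0 - r 1 = (1 + b) / (3 + b)"
      using ab by (simp_all add: p_def r_def digit_prob_def divide_simps) (simp_all add: algebra_simps)
    then have "(1 - p 0 - p 1) - (1 - r 0 - r 1) = (1 + a) / (3 + a) - (1 + b) / (3 + b)" by simp
    also have "\<dots> = 2 * (a - b) / ((3 + a) * (3 + b))"
      using ab by (simp add: divide_simps) (simp add: algebra_simps)
    also have "\<dots> \<le> 2 * (a - b) / (3 * 3)"
      using ab by (intro divide_left_mono mult_mono) auto
    finally show ?thesis by simp
  qed
  have shift: "(\<lambda>n. f (n + 2)) sums (s - (\<Sum>i<2. f i))" if "f sums s" for f :: "nat \<Rightarrow> real" and s
    using that by (subst sums_iff_shift) simp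
  have "(\<lambda>n. K * (a - b) / 4 * p (n + 2) + (p (n + 2) - r (n + 2)) * K) sums
      (K * (a - b) / 4 * (1 - (\<Sum>i<2. p i)) + ((1 - (\<Sum>i<2. p i)) - (1 - (\<Sum>i<2. r i))) * K)"
    by (intro sums_add sums_mult sums_mult2 sums_diff shift p_sums r_sums)
  moreover have "(\<lambda>n. v (n + 2)) sums (A - B - (\<Sum>i<2. v i))"
    using shift[OF v_sums] by simp
  moreover have "norm (v (n + 2)) \<le> K * (a - b) / 4 * p (n + 2) + (p (n + 2) - r (n + 2)) * K" for n
  proof -
    have "r (n + 2) \<le> p (n + 2)"
      unfolding p_def r_def by (rule digit_prob_diff_nonneg[OF ab]) simp
    then have "\<bar>p (n + 2) - r (n + 2)\<bar> = p (n + 2) - r (n + 2)" by (simp only: abs_of_nonneg diff_ge_0_iff_ge)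
    moreover have "1 \<le> n + 2" by simp
    ultimately show ?thesis using vn[of "n + 2"] by (simp only: real_norm_def)
  qed
  ultimately have "norm (A - B - (\<Sum>i<2. v i)) \<le>
      K * (a - b) / 4 * (1 - (\<Sum>i<2. p i)) + ((1 - (\<Sum>i<2. p i)) - (1 - (\<Sum>i<2. r i))) * K"
    using norm_sums_le by blast
  then have "\<bar>A - B - (v 0 + v 1)\<bar> \<le>
      K * (a - b) / 4 * (1 - p 0 - p 1) + ((1 - p 0 - p 1) - (1 - r 0 - r 1)) * K"
    by (simp add: numeral_2_eq_2 diff_diff_eq)
  also have "\<dots> \<le> K * (a - b) / 4 * (1 - p 0 - p 1) + (2 / 9 * (a - b)) * K"
    using tail3 K by (intro add_left_mono mult_right_mono) auto
  finally have "\<bar>A - B\<bar> \<le> K * (a - b) / 4 * (1 - p 0 - p 1) + (2 / 9 * (a - b)) * K + \<bar>v 0\<bar> + \<bar>v 1\<bar>"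
    by linarith
  also have "\<bar>v 1\<bar> \<le> K * (a - b) / 4 * p 1 + (a - b) / 18 * K"
    using vn[of 1] mult_right_mono[OF abs1 K] by linarith
  also note v0
  also have "K * (a - b) / 4 * (1 - p 0 - p 1) + 2 / 9 * (a - b) * K + K * (a - b) * p 0 +
      (K * (a - b) / 4 * p 1 + (a - b) / 18 * K) = K * (a - b) * (1 / 4 + 2 / 9 + 1 / 18 + 3 / 4 * p 0)"
    by (simp add: field_simps)
  also have "\<dots> \<le> K * (a - b) * (65 / 72)"
    using p0_le K ab by (intro mult_left_mono) auto
  finally show ?thesis by (simp add: mult.commute)
qed

lemma averaging_contraction:
  fixes \<phi> :: "real \<Rightarrow> real"
  assumes lip: "\<And>s t. s \<in> {0..1} \<Longrightarrow> t \<in> {0..1} \<Longrightarrow> \<bar>\<phi> s - \<phi> t\<bar> \<le> K * \<bar>s - t\<bar>"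
    and ab: "a \<in> {0..1}" "b \<in> {0..1}"
    and A: "(\<lambda>n. digit_prob (Suc n) a * \<phi> (1 / (real (Suc n) + a))) sums A"
    and B: "(\<lambda>n. digit_prob (Suc n) b * \<phi> (1 / (real (Suc n) + b))) sums B"
  shows "\<bar>A - B\<bar> \<le> 65 / 72 * K * \<bar>a - b\<bar>"
proof (cases "b \<le> a")
  case True
  then show ?thesis using averaging_contraction_aux[OF lip, of b a] assms by (simp add: mult.assoc)
next
  case False
  then have "\<bar>B - A\<bar> \<le> 65 / 72 * (K * (b - a))"
    using ab by (intro averaging_contraction_aux[OF lip _ _ _ B A]) auto
  then show ?thesis using False by (simp add: mult.assoc abs_minus_commute)
qed

lemma nu_lipschitz:
  assumes ab: "a \<in> {0..1}" "b \<in> {0..1}" and B: "B \<subseteq> irr" "B \<in> sets borel"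
  shows "\<bar>nu a B - nu b B\<bar> \<le> 4 * nu 0 B * \<bar>a - b\<bar>"
proof -
  note BI = order_trans[OF B(1) irr_subset]
  have wl: "weight (cyl_density c)" if "c \<in> {0..1}" for c using weight_cyl_density that by auto
  have le: "nu s B - nu t B \<le> 4 * nu 0 B * \<bar>s - t\<bar>" if st: "s \<in> {0..1}" "t \<in> {0..1}" for s t
  proof -
    have "cyl_density s y - cyl_density t y \<le> 4 * \<bar>s - t\<bar> * cyl_density 0 y" if "y \<in> B" for y
    proof -
      have y: "0 \<le> y" "y \<le> 1" using that BI by auto
      define c where "c = 1 - 2 * y - y\<^sup>2 * (s + t) - y\<^sup>2 * (s * t)"
      have y2: "0 \<le> y\<^sup>2" "y\<^sup>2 \<le> 1" using y by (auto simp: power_le_one)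
      have st2: "0 \<le> s * t" "s * t \<le> 1" using st mult_mono[of s 1 t 1] by auto
      have sy: "0 \<le> s * y" "0 \<le> t * y" using st y by auto
      have "y\<^sup>2 * (s + t) \<le> 1 * 2" using y2 st by (intro mult_mono) auto
      moreover have "y\<^sup>2 * (s * t) \<le> 1 * 1" using y2 st2 by (intro mult_mono) auto
      moreover have "0 \<le> y\<^sup>2 * (s + t)" "0 \<le> y\<^sup>2 * (s * t)" using y2 st st2 by auto
      ultimately have c: "\<bar>c\<bar> \<le> 4" using y unfolding c_def by linarith
      define W where "W = (1 + s * y)\<^sup>2 * (1 + t * y)\<^sup>2"
      have W1: "1 * 1 \<le> W" unfolding W_def using sy by (intro mult_mono) (auto intro!: one_le_power)
      have "cyl_density s y - cyl_density t y = ((1 + s) * (1 + t * y)\<^sup>2 - (1 + t) * (1 + s * y)\<^sup>2) / W"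
        unfolding cyl_density_def W_def using sy by (subst diff_frac_eq) auto
      also have "(1 + s) * (1 + t * y)\<^sup>2 - (1 + t) * (1 + s * y)\<^sup>2 = (s - t) * c"
        unfolding c_def by (simp add: algebra_simps power2_eq_square)
      also have "(s - t) * c / W \<le> \<bar>(s - t) * c\<bar> / 1"
        using W1 by (intro frac_le) auto
      also have "\<dots> \<le> \<bar>s - t\<bar> * 4" unfolding abs_mult using c by (simp add: mult_left_mono)
      finally show ?thesis by (simp add: cyl_density_def mult.commute)
    qed
    then have "integral B (\<lambda>y. cyl_density s y - cyl_density t y)
        \<le> integral B (\<lambda>y. 4 * \<bar>s - t\<bar> * cyl_density 0 y)"
      using weighted_integral(4)[OF wl B(2) BI] st
      by (intro integral_le integrable_diff integrable_on_mult_right) auto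
    also have "\<dots> = 4 * \<bar>s - t\<bar> * nu 0 B"
      unfolding nu_def using weighted_integral(3)[OF wl B(2) BI, of 0] by simp
    also have "integral B (\<lambda>y. cyl_density s y - cyl_density t y) = nu s B - nu t B"
      unfolding nu_def using weighted_integral(3,4)[OF wl B(2) BI] st
      by (simp add: integral_diff)
    finally show ?thesis by (simp add: mult_ac)
  qed
  show ?thesis using le[OF ab] le[OF ab(2,1)] by (simp add: abs_le_iff abs_minus_commute)
qed

lemma funpow_pre_borel: "B \<in> sets borel \<Longrightarrow> (pre ^^ m) B \<in> sets borel"
  by (induction m) (auto intro: pre_borel)

lemma funpow_pre_subset: "B \<subseteq> irr \<Longrightarrow> (pre ^^ m) B \<subseteq> irr"
  by (induction m) (use pre_subset in auto)

text \<open>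
  Since \<open>nu a (pre B)\<close> is the average of \<open>nu (1/(d + a)) B\<close> over the digits, the contraction of
  averages applies at each step: the law of the far future forgets the parameter exponentially fast.
\<close>
lemma nu_pre_contraction:
  assumes B: "B \<subseteq> irr" "B \<in> sets borel"
  shows "a \<in> {0..1} \<Longrightarrow> b \<in> {0..1} \<Longrightarrow>
    \<bar>nu a ((pre ^^ m) B) - nu b ((pre ^^ m) B)\<bar> \<le> (65 / 72) ^ m * (4 * nu 0 B) * \<bar>a - b\<bar>"
proof (induction m arbitrary: a b)
  case 0
  then show ?case using nu_lipschitz[OF _ _ B] by simp
next
  case (Suc m)
  let ?S = "(pre ^^ m) B"
  have S: "?S \<subseteq> irr" "?S \<in> sets borel"
    using B by (auto intro: funpow_pre_borel dest: funpow_pre_subset[of B m])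
  have "\<bar>nu a (pre ?S) - nu b (pre ?S)\<bar> \<le> 65 / 72 * ((65 / 72) ^ m * (4 * nu 0 B)) * \<bar>a - b\<bar>"
    using Suc.prems by (intro averaging_contraction[OF Suc.IH] nu_pre_sums S) auto
  then show ?case by (simp add: mult.assoc)
qed

text \<open>
  The Gauss measure is a mixture of the laws \<open>nu a\<close>, because
  \<open>1 / (1 + y)\<close> is the integral of \<open>1 / (1 + a y)\<^sup>2\<close> over \<open>a\<close> in the unit interval. This
  identifies the common limit of the contraction as the Gauss measure.
\<close>
lemma mu_mixture_eq:
  assumes S: "S \<subseteq> irr" "S \<in> sets borel"
  shows "ennreal (ln 2 * mu S) = (\<integral>\<^sup>+a. ennreal (nu a S / (1 + a)) * indicator {0..1} a \<partial>lborel)"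
proof -
  note SI = order_trans[OF S(1) irr_subset]
  note [measurable] = S(2)
  have w: "weight (\<lambda>y. 1 / (1 + y))" by (auto simp: weight_def intro!: continuous_intros)
  have pos: "0 < 1 + a * y" if "a \<in> {0..1}" "y \<in> {0..1}" for a y :: real
    using that by (intro add_pos_nonneg) auto
  have inner: "(\<integral>\<^sup>+a. ennreal (1 / (1 + a * y)\<^sup>2) * indicator {0..1} a \<partial>lborel) = ennreal (1 / (1 + y))"
    if "y \<in> {0..1}" for y :: real
  proof -
    have "(\<integral>\<^sup>+a. ennreal (1 / (1 + a * y)\<^sup>2) * indicator {0..1} a \<partial>lborel)
        = ennreal (1 / (1 + 1 * y) - 0 / (1 + 0 * y))"
    proof (rule nn_integral_FTC_Icc)
      fix a :: real assume "a \<in> {0..1}"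
      then show "((\<lambda>a. a / (1 + a * y)) has_real_derivative 1 / (1 + a * y)\<^sup>2) (at a)"
      proof -
        have ne: "1 + a * y \<noteq> 0" using pos[OF \<open>a \<in> {0..1}\<close> that] by simp
        have "((\<lambda>a. a / (1 + a * y)) has_real_derivative
            (1 * (1 + a * y) - a * (0 + 1 * y)) / ((1 + a * y) * (1 + a * y))) (at a)"
          by (intro DERIV_divide DERIV_add DERIV_const DERIV_ident DERIV_cmult_right ne)
        moreover have "(1 * (1 + a * y) - a * (0 + 1 * y)) / ((1 + a * y) * (1 + a * y))
            = 1 / (1 + a * y)\<^sup>2"
          unfolding power2_eq_square by simp
        ultimately show ?thesis by metis
      qed
      show "0 \<le> 1 / (1 + a * y)\<^sup>2" by simp
    next
      show "(\<lambda>a. 1 / (1 + a * y)\<^sup>2) \<in> borel_measurable borel" by measurable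
    qed simp
    then show ?thesis by simp
  qed
  have "ln 2 * mu S = integral S (\<lambda>y. 1 / (1 + y))"
  proof -
    have "gauss_density = (\<lambda>y. (1 / ln 2) * (1 / (1 + y)))" by (auto simp: gauss_density_def)
    then have "mu S = integral S (\<lambda>y. (1 / ln 2) * (1 / (1 + y)))"
      using weighted_integral(3)[OF weight_gauss_density S(2) SI] by (simp add: mu_def)
    also have "\<dots> = (1 / ln 2) * integral S (\<lambda>y. 1 / (1 + y))" by (rule integral_mult_right)
    finally show ?thesis by simp
  qed
  then have "ennreal (ln 2 * mu S) = emeasure (weighted (\<lambda>y. 1 / (1 + y))) S"
    using weighted_integral(1)[OF w S(2) SI] by simp
  also have "\<dots> = (\<integral>\<^sup>+y. ennreal (1 / (1 + y)) * indicator S y \<partial>lborel)"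
    unfolding weighted_def using SI
    by (subst emeasure_density) (auto intro!: nn_integral_cong simp: indicator_def)
  also have "\<dots> = (\<integral>\<^sup>+y. (\<integral>\<^sup>+a. ennreal (1 / (1 + a * y)\<^sup>2) * indicator {0..1} a * indicator S y \<partial>lborel) \<partial>lborel)"
    using inner SI by (intro nn_integral_cong) (auto simp: nn_integral_multc indicator_def)
  also have "\<dots> = (\<integral>\<^sup>+a. (\<integral>\<^sup>+y. ennreal (1 / (1 + a * y)\<^sup>2) * indicator {0..1} a * indicator S y \<partial>lborel) \<partial>lborel)"
    by (rule lborel_pair.Fubini') measurable
  also have "\<dots> = (\<integral>\<^sup>+a. ennreal (nu a S / (1 + a)) * indicator {0..1} a \<partial>lborel)"
  proof (rule nn_integral_cong)
    fix a :: real
    show "(\<integral>\<^sup>+y. ennreal (1 / (1 + a * y)\<^sup>2) * indicator {0..1} a * indicator S y \<partial>lborel)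
        = ennreal (nu a S / (1 + a)) * indicator {0..1} a"
    proof (cases "a \<in> {0..1}")
      case True
      have w': "weight (\<lambda>y. 1 / (1 + a * y)\<^sup>2)"
        unfolding weight_def using pos[OF True] by (auto intro!: continuous_intros simp: less_imp_neq[THEN not_sym])
      have "nu a S / (1 + a) = integral S (\<lambda>y. 1 / (1 + a * y)\<^sup>2)"
      proof -
        have "cyl_density a = (\<lambda>y. (1 + a) * (1 / (1 + a * y)\<^sup>2))" by (auto simp: cyl_density_def)
        then have "nu a S = integral S (\<lambda>y. (1 + a) * (1 / (1 + a * y)\<^sup>2))"
          using weighted_integral(3)[OF weight_cyl_density S(2) SI, of a] True by (simp add: nu_def)
        also have "\<dots> = (1 + a) * integral S (\<lambda>y. 1 / (1 + a * y)\<^sup>2)" by (rule integral_mult_right)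
        finally show ?thesis using True by simp
      qed
      then have "ennreal (nu a S / (1 + a)) = emeasure (weighted (\<lambda>y. 1 / (1 + a * y)\<^sup>2)) S"
        using weighted_integral(1)[OF w' S(2) SI] by simp
      also have "\<dots> = (\<integral>\<^sup>+y. ennreal (1 / (1 + a * y)\<^sup>2) * indicator S y \<partial>lborel)"
        unfolding weighted_def using SI
        by (subst emeasure_density) (auto intro!: nn_integral_cong simp: indicator_def)
      finally show ?thesis using True by simp
    qed simp
  qed
  finally show ?thesis .
qed

lemma mixture_const: "0 \<le> c \<Longrightarrow>
  (\<integral>\<^sup>+a. ennreal (c / (1 + a)) * indicator {0..1} a \<partial>lborel) = ennreal (ln 2 * c)"
proof -
  assume c: "0 \<le> c"
  have "(\<integral>\<^sup>+a. ennreal (c / (1 + a)) * indicator {0..1} a \<partial>lborel)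
      = ennreal (c * ln (1 + 1) - c * ln (1 + 0))"
  proof (rule nn_integral_FTC_Icc)
    fix a :: real assume "a \<in> {0..1}"
    then show "((\<lambda>a. c * ln (1 + a)) has_real_derivative c / (1 + a)) (at a)"
      by (auto intro!: derivative_eq_intros)
  qed (use c in auto)
  then show ?thesis by (simp add: mult.commute)
qed

lemma mu_between:
  assumes S: "S \<subseteq> irr" "S \<in> sets borel"
    and le: "\<And>a. a \<in> {0..1} \<Longrightarrow> c \<le> nu a S" "\<And>a. a \<in> {0..1} \<Longrightarrow> nu a S \<le> C"
  shows "c \<le> mu S" "mu S \<le> C"
proof -
  have m0: "0 \<le> mu S" by (simp add: mu_def)
  have C0: "0 \<le> C" using le(2)[of 0] by (rule order_trans[rotated]) (simp_all add: nu_def)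
  have "ennreal (ln 2 * mu S) \<le> (\<integral>\<^sup>+a. ennreal (C / (1 + a)) * indicator {0..1} a \<partial>lborel)"
    unfolding mu_mixture_eq[OF S] using le(2)
    by (intro nn_integral_mono) (auto simp: indicator_def intro!: ennreal_leI divide_right_mono)
  then show "mu S \<le> C" using C0 by (simp add: mixture_const)
  have "(\<integral>\<^sup>+a. ennreal (max 0 c / (1 + a)) * indicator {0..1} a \<partial>lborel) \<le> ennreal (ln 2 * mu S)"
    unfolding mu_mixture_eq[OF S] using le(1)
    by (intro nn_integral_mono) (auto simp: indicator_def nu_def intro!: ennreal_leI divide_right_mono)
  then have "max 0 c \<le> mu S" using m0 by (simp add: mixture_const)
  then show "c \<le> mu S" by simp
qed

text \<open>
  Gauss--Kuzmin--Levy in a relative form: the error is proportional to the measure of \<open>B\<close>. This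
  matters, because later \<open>B\<close> is itself an event of exponentially small measure.
\<close>
lemma nu_pre_mu:
  assumes B: "B \<subseteq> irr" "B \<in> sets borel" and a: "a \<in> {0..1}"
  shows "\<bar>nu a ((pre ^^ m) B) - mu ((pre ^^ m) B)\<bar> \<le> (65 / 72) ^ m * (4 * nu 0 B)"
proof -
  let ?S = "(pre ^^ m) B" and ?e = "(65 / 72) ^ m * (4 * nu 0 B)"
  have S: "?S \<subseteq> irr" "?S \<in> sets borel"
    using B by (auto intro: funpow_pre_borel dest: funpow_pre_subset[of B m])
  have "\<bar>nu a ?S - nu b ?S\<bar> \<le> ?e" if b: "b \<in> {0..1}" for b
  proof -
    have "\<bar>nu a ?S - nu b ?S\<bar> \<le> ?e * \<bar>a - b\<bar>" by (rule nu_pre_contraction[OF B a b])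
    also have "\<dots> \<le> ?e * 1" using a b by (intro mult_left_mono) (auto simp: nu_def)
    finally show ?thesis by simp
  qed
  then have "\<bar>nu a ?S - nu b ?S\<bar> \<le> ?e" if "b \<in> {0..1}" for b by (simp only: that)
  then have "nu a ?S - ?e \<le> nu b ?S" "nu b ?S \<le> nu a ?S + ?e" if "b \<in> {0..1}" for b
    using abs_le_D1 abs_le_D2 that by (smt (verit))+
  from mu_between[OF S this] have "nu a ?S - ?e \<le> mu ?S" "mu ?S \<le> nu a ?S + ?e" by blast+
  then show ?thesis by linarith
qed

section \<open>Blocks of ones\<close>

lemma cf_digit_Suc_0: "cf_digit (Suc 0) x = \<lfloor>1 / x\<rfloor>"
  by (simp add: cf_digit_def)

lemma cf_digit_Suc: "cf_digit (Suc (Suc i)) x = cf_digit (Suc i) (gauss_map x)"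
  by (simp add: cf_digit_def funpow_swap1)

lemma no_ones_block_set_subset: "no_ones_block_set k n \<subseteq> irr"
  by (auto simp: no_ones_block_set_def irr_def)

lemma has_ones_block_iff:
  "has_ones_block k n x \<longleftrightarrow> (\<exists>i. i + k \<le> n \<and> (\<forall>j<k. cf_digit (Suc (i + j)) x = 1))"
proof
  assume "has_ones_block k n x"
  then obtain i where i: "1 \<le> i" "i + k \<le> n + 1" "\<forall>j\<in>{i..<i + k}. cf_digit j x = 1"
    by (auto simp: has_ones_block_def)
  then show "\<exists>i. i + k \<le> n \<and> (\<forall>j<k. cf_digit (Suc (i + j)) x = 1)"
    by (intro exI[of _ "i - 1"]) auto
next
  assume "\<exists>i. i + k \<le> n \<and> (\<forall>j<k. cf_digit (Suc (i + j)) x = 1)"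
  then obtain i where i: "i + k \<le> n" "\<And>j. j < k \<Longrightarrow> cf_digit (Suc (i + j)) x = 1" by blast
  have "cf_digit j x = 1" if "j \<in> {Suc i..<Suc i + k}" for j
    using i(2)[of "j - Suc i"] that by auto
  then show "has_ones_block k n x"
    unfolding has_ones_block_def using i(1) by (intro exI[of _ "Suc i"]) auto
qed

lemma has_ones_block_Suc:
  "has_ones_block k (Suc n) x \<longleftrightarrow>
    (k \<le> Suc n \<and> (\<forall>j<k. cf_digit (Suc j) x = 1)) \<or> has_ones_block k n (gauss_map x)"
proof -
  have split: "(\<exists>i. P i) \<longleftrightarrow> P 0 \<or> (\<exists>i. P (Suc i))" for P :: "nat \<Rightarrow> bool"
    by (metis not0_implies_Suc)
  show ?thesis unfolding has_ones_block_iff by (subst split) (simp add: cf_digit_Suc)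
qed

lemma has_ones_block_mono: "has_ones_block k n x \<Longrightarrow> n \<le> n' \<Longrightarrow> has_ones_block k n' x"
  unfolding has_ones_block_def by (meson add_le_mono1 order_trans)

definition ones :: "nat \<Rightarrow> real set" where
  "ones k = (branch (Suc 0) ^^ k) irr"

lemma funpow_branch_subset: "B \<subseteq> irr \<Longrightarrow> (branch (Suc 0) ^^ k) B \<subseteq> irr"
  by (induction k) (use branch_subset[of "Suc 0"] in auto)

lemma funpow_branch_borel: "B \<subseteq> irr \<Longrightarrow> B \<in> sets borel \<Longrightarrow> (branch (Suc 0) ^^ k) B \<in> sets borel"
  by (induction k) (simp_all add: branch_borel funpow_branch_subset)

lemma funpow_gauss_map_irr: "x \<in> irr \<Longrightarrow> (gauss_map ^^ k) x \<in> irr"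
  by (induction k) (auto intro: gauss_map_irr)

lemma all_less_Suc_split: "(\<forall>j<Suc k. P j) \<longleftrightarrow> P 0 \<and> (\<forall>j<k. P (Suc j))"
  by (metis Suc_less_eq not0_implies_Suc zero_less_Suc)

lemma funpow_branch_iff:
  assumes "B \<subseteq> irr"
  shows "x \<in> (branch (Suc 0) ^^ k) B \<longleftrightarrow>
    x \<in> irr \<and> (\<forall>j<k. cf_digit (Suc j) x = 1) \<and> (gauss_map ^^ k) x \<in> B"
proof (induction k arbitrary: x)
  case 0
  then show ?case using assms by auto
next
  case (Suc k)
  have "x \<in> (branch (Suc 0) ^^ Suc k) B \<longleftrightarrow>
      x \<in> irr \<and> \<lfloor>1 / x\<rfloor> = 1 \<and> gauss_map x \<in> (branch (Suc 0) ^^ k) B"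
    using branch_eq[of "Suc 0", OF _ funpow_branch_subset[OF assms, of k]] by simp
  also have "\<dots> \<longleftrightarrow> x \<in> irr \<and> (\<forall>j<Suc k. cf_digit (Suc j) x = 1) \<and> (gauss_map ^^ Suc k) x \<in> B"
    unfolding Suc.IH all_less_Suc_split using gauss_map_irr(1)[of x]
    by (auto simp: cf_digit_Suc cf_digit_Suc_0 funpow_swap1)
  finally show ?case .
qed

lemma no_ones_block_set_Suc:
  "no_ones_block_set k (Suc n) = pre (no_ones_block_set k n) - (if k \<le> Suc n then ones k else {})"
proof (intro set_eqI)
  fix x
  show "x \<in> no_ones_block_set k (Suc n) \<longleftrightarrow>
      x \<in> pre (no_ones_block_set k n) - (if k \<le> Suc n then ones k else {})"
    using gauss_map_irr(1)[of x] funpow_gauss_map_irr[of x k]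
    by (auto simp: no_ones_block_set_def irr_def[symmetric] pre_def ones_def
        funpow_branch_iff[OF order_refl] has_ones_block_Suc)
qed

lemma no_ones_block_set_0: "1 \<le> k \<Longrightarrow> no_ones_block_set k 0 = irr"
  by (auto simp: no_ones_block_set_def irr_def has_ones_block_def)

lemma no_ones_block_set_borel: "1 \<le> k \<Longrightarrow> no_ones_block_set k n \<in> sets borel"
proof (induction n)
  case (Suc n)
  then show ?case using funpow_branch_borel[OF order_refl irr_borel]
    by (auto simp: no_ones_block_set_Suc ones_def intro: pre_borel)
qed (simp add: no_ones_block_set_0 irr_borel)

lemma no_ones_block_set_antimono: "n \<le> n' \<Longrightarrow> no_ones_block_set k n' \<subseteq> no_ones_block_set k n"
  by (auto simp: no_ones_block_set_def dest: has_ones_block_mono)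

lemma pre_mono: "A \<subseteq> B \<Longrightarrow> pre A \<subseteq> pre B"
  by (auto simp: pre_def)

lemma no_ones_block_set_add:
  "no_ones_block_set k (n + m) \<subseteq> (pre ^^ n) (no_ones_block_set k m)"
proof (induction n)
  case (Suc n)
  have "no_ones_block_set k (Suc n + m) \<subseteq> pre (no_ones_block_set k (n + m))"
    by (auto simp: no_ones_block_set_Suc)
  also have "\<dots> \<subseteq> pre ((pre ^^ n) (no_ones_block_set k m))" by (rule pre_mono[OF Suc])
  finally show ?case by simp
qed simp

text \<open>
  If a block of \<open>k\<close> digits 1 sits at the very beginning and none among the digits 2 to \<open>n + k + 1\<close>,
  then digit \<open>k + 1\<close> is not 1. No later block can contain this digit, so the condition splits into
  \<open>k\<close> digits 1, one digit other than 1 and a remainder that has no block among its first \<open>n\<close> digits.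
\<close>
lemma first_block_removal:
  assumes k: "1 \<le> k"
  shows "ones k \<inter> pre (no_ones_block_set k (n + k)) =
    (branch (Suc 0) ^^ k) (pre (no_ones_block_set k n) - branch (Suc 0) (no_ones_block_set k n))"
proof -
  let ?A = "no_ones_block_set k"
  \<comment> \<open>Claim \<open>skip\<close>: a run of fewer than \<open>k\<close> digits 1 and the digit ending it can be dropped.\<close>
  define Y where "Y = {y \<in> irr. \<lfloor>1 / y\<rfloor> \<noteq> 1}"
  have Y: "Y \<subseteq> irr" by (auto simp: Y_def)
  note A = no_ones_block_set_subset[of k]
  have not_ones: "x \<notin> ones k" if x: "x \<in> (branch (Suc 0) ^^ j) Y" and "j < k" for x j
  proof
    assume "x \<in> ones k"
    then have "cf_digit (Suc j) x = 1"
      using \<open>j < k\<close> by (auto simp: ones_def funpow_branch_iff[OF order_refl])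
    moreover have "cf_digit (Suc j) x = \<lfloor>1 / (gauss_map ^^ j) x\<rfloor>" by (simp add: cf_digit_def)
    moreover have "(gauss_map ^^ j) x \<in> Y" using x by (simp add: funpow_branch_iff[OF Y])
    ultimately show False by (simp add: Y_def)
  qed
  have skip: "x \<in> ?A (n + Suc j) \<longleftrightarrow> (gauss_map ^^ Suc j) x \<in> ?A n"
    if "x \<in> (branch (Suc 0) ^^ j) Y" "j < k" for x j
    using that
  proof (induction j arbitrary: x)
    case 0
    then show ?case using not_ones[of x 0] Y by (auto simp: no_ones_block_set_Suc pre_def)
  next
    case (Suc j)
    have x: "x \<in> irr" using Suc.prems funpow_branch_subset[OF Y] by blast
    have Tx: "gauss_map x \<in> (branch (Suc 0) ^^ j) Y"
      using Suc.prems branch_eq[of "Suc 0", OF _ funpow_branch_subset[OF Y, of j]] by simp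
    have "x \<in> ?A (n + Suc (Suc j)) \<longleftrightarrow> gauss_map x \<in> ?A (n + Suc j)"
      using not_ones[OF Suc.prems] x by (simp add: no_ones_block_set_Suc pre_def)
    also have "\<dots> \<longleftrightarrow> (gauss_map ^^ Suc j) (gauss_map x) \<in> ?A n"
      using Suc.prems by (intro Suc.IH[OF Tx]) simp
    finally show ?case by (simp only: funpow_Suc_right o_apply)
  qed
  obtain j where j: "k = Suc j" using k by (cases k) auto
  have D: "pre (?A n) - branch (Suc 0) (?A n) = {y \<in> Y. gauss_map y \<in> ?A n}"
    using branch_eq[of "Suc 0", OF _ A[of n]] by (auto simp: pre_def Y_def)
  have D': "{y \<in> Y. gauss_map y \<in> ?A n} \<subseteq> irr" using Y by auto
  show ?thesis
  proof (intro set_eqI)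
    fix x
    show "x \<in> ones k \<inter> pre (?A (n + k)) \<longleftrightarrow>
      x \<in> (branch (Suc 0) ^^ k) (pre (?A n) - branch (Suc 0) (?A n))"
    proof (cases "x \<in> ones k")
      case False
      then show ?thesis unfolding D ones_def
        using funpow_gauss_map_irr[of x k] by (auto simp: funpow_branch_iff[OF D'] funpow_branch_iff[OF order_refl])
    next
      case True
      then have x: "x \<in> irr" and dig: "\<forall>i<k. cf_digit (Suc i) x = 1"
        by (auto simp: ones_def funpow_branch_iff[OF order_refl])
      define y where "y = (gauss_map ^^ k) x"
      have y: "y \<in> irr" unfolding y_def by (rule funpow_gauss_map_irr[OF x])
      have yj: "y = (gauss_map ^^ j) (gauss_map x)" by (simp add: y_def j funpow_swap1)
      have Tx: "gauss_map x \<in> irr" by (rule gauss_map_irr[OF x])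
      have dTx: "\<forall>i<j. cf_digit (Suc i) (gauss_map x) = 1"
        using dig by (simp add: j all_less_Suc_split cf_digit_Suc)
      have "gauss_map x \<in> ?A (n + Suc j) \<longleftrightarrow> y \<in> Y \<and> gauss_map y \<in> ?A n"
      proof (cases "y \<in> Y")
        case True
        then have "gauss_map x \<in> (branch (Suc 0) ^^ j) Y"
          using Tx dTx yj by (simp add: funpow_branch_iff[OF Y])
        from skip[OF this] show ?thesis using True j yj by simp
      next
        case False
        then have "\<lfloor>1 / y\<rfloor> = 1" using y by (simp add: Y_def)
        then have "cf_digit (Suc j) (gauss_map x) = 1" by (simp add: cf_digit_def yj)
        with dTx have "\<forall>i<k. cf_digit (Suc i) (gauss_map x) = 1"
          by (auto simp: j less_Suc_eq)
        then have "gauss_map x \<in> ones k"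
          unfolding ones_def using Tx funpow_gauss_map_irr[OF Tx]
          by (simp add: funpow_branch_iff[OF order_refl])
        then show ?thesis using False j by (simp add: no_ones_block_set_Suc)
      qed
      moreover have "x \<in> (branch (Suc 0) ^^ k) {y \<in> Y. gauss_map y \<in> ?A n} \<longleftrightarrow> y \<in> Y \<and> gauss_map y \<in> ?A n"
        unfolding funpow_branch_iff[OF D'] y_def[symmetric] using x dig by simp
      ultimately show ?thesis unfolding D using True x by (simp add: pre_def j)
    qed
  qed
qed

section \<open>Existence of the decay rate\<close>

lemma ones_free_measure_nu:
  assumes "1 \<le> k"
  shows "ones_free_measure k n = nu 0 (no_ones_block_set k n)"
proof -
  let ?A = "no_ones_block_set k n"
  have A: "?A \<subseteq> {0..1}" "?A \<in> sets borel"
    using no_ones_block_set_subset irr_subset no_ones_block_set_borel[OF assms] by blast+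
  then have "?A \<in> lmeasurable"
    by (intro bounded_set_imp_lmeasurable) (auto intro: bounded_subset[OF bounded_closed_interval] sets_completionI_sets)
  then have "measure lebesgue ?A = integral ?A (\<lambda>_. 1)" by (rule lmeasure_integral)
  then show ?thesis
    using weighted_integral(3)[OF weight_cyl_density A(2,1), of 0]
    by (simp add: ones_free_measure_def nu_def cyl_density_def[abs_def])
qed

lemma nu_le_nu_0:
  assumes "B \<subseteq> irr" "B \<in> sets borel" "a \<in> {0..1}"
  shows "nu a B \<le> 2 * nu 0 B"
  unfolding nu_def
proof (intro weighted_le weight_cyl_density)
  fix y assume "y \<in> B"
  then have "0 \<le> a * y" using assms irr_bounds[of y] by auto
  then have "1 \<le> (1 + a * y)\<^sup>2" by simp
  then have "cyl_density a y \<le> 2 / 1"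
    unfolding cyl_density_def using assms by (intro frac_le) auto
  then show "cyl_density a y \<le> 2 * cyl_density 0 y" by (simp add: cyl_density_def)
qed (use assms irr_subset in auto)

text \<open>
  Unions of cylinders of rank \<open>n\<close>, with the irrational points only.
\<close>
definition digit_determined :: "nat \<Rightarrow> real set \<Rightarrow> bool" where
  "digit_determined n Q \<longleftrightarrow> Q \<subseteq> irr \<and> (\<forall>x\<in>irr. \<forall>y\<in>irr.
     (\<forall>j<n. cf_digit (Suc j) x = cf_digit (Suc j) y) \<longrightarrow> x \<in> Q \<longrightarrow> y \<in> Q)"

lemma digit_determined_no_ones_block_set: "digit_determined n (no_ones_block_set k n)"
proof -
  have "has_ones_block k n x"
    if "\<forall>j<n. cf_digit (Suc j) x = cf_digit (Suc j) y" "has_ones_block k n y" for x y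
    using that unfolding has_ones_block_iff by (metis add_less_cancel_left order_less_le_trans)
  then show ?thesis
    by (auto simp: digit_determined_def no_ones_block_set_def irr_def)
qed

text \<open>
  Given the first \<open>n\<close> digits the future is distributed by some \<open>nu a\<close>, so a bound that is uniform in
  \<open>a\<close> factors out.
\<close>
lemma nu_quasi_independent:
  assumes B: "B \<subseteq> irr" "B \<in> sets borel" and M: "\<And>a. a \<in> {0..1} \<Longrightarrow> nu a B \<le> M"
  shows "a \<in> {0..1} \<Longrightarrow> Q \<in> sets borel \<Longrightarrow> digit_determined n Q \<Longrightarrow>
    nu a (Q \<inter> (pre ^^ n) B) \<le> M * nu a Q"
proof (induction n arbitrary: a Q)
  case 0
  have "Q = {} \<or> Q = irr" using 0 by (auto simp: digit_determined_def)
  then show ?case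
  proof
    assume "Q = irr"
    then have "Q \<inter> (pre ^^ 0) B = B" using B by auto
    then show ?thesis using \<open>Q = irr\<close> nu_irr[of a] M[of a] 0 by simp
  qed (simp add: nu_def)
next
  case (Suc n)
  define R where "R i = {y \<in> irr. 1 / (real (Suc i) + y) \<in> Q}" for i
  have R: "R i \<subseteq> irr" for i by (auto simp: R_def)
  have Rm: "R i \<in> sets borel" for i
  proof -
    note [measurable] = Suc.prems(2)
    have "{y \<in> space borel. y \<in> irr \<and> 1 / (real (Suc i) + y) \<in> Q} \<in> sets borel" by measurable
    then show ?thesis by (simp add: R_def)
  qed
  have QI: "Q \<subseteq> irr" using Suc.prems(3) by (simp add: digit_determined_def)
  have cover: "\<exists>i. \<lfloor>1 / x\<rfloor> = int (Suc i) \<and> gauss_map x \<in> R i" if "x \<in> Q" for x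
  proof -
    have x: "x \<in> irr" using that QI by auto
    define i where "i = nat \<lfloor>1 / x\<rfloor> - 1"
    have i: "\<lfloor>1 / x\<rfloor> = int (Suc i)" using gauss_map_irr(2)[OF x] unfolding i_def by linarith
    then have "1 / (real (Suc i) + gauss_map x) = x" using gauss_map_irr(3)[OF x] by simp
    then show ?thesis using i that gauss_map_irr(1)[OF x] unfolding R_def by auto
  qed
  have in_Q: "x \<in> Q" if "x \<in> irr" "\<lfloor>1 / x\<rfloor> = int (Suc i)" "gauss_map x \<in> R i" for x i
    using that gauss_map_irr(3)[of x] by (simp add: R_def)
  have Q_eq: "Q = (\<Union>i. branch (Suc i) (R i))"
    using cover in_Q QI by (auto simp: branch_eq[OF _ R] subset_eq)
  let ?B = "(pre ^^ n) B"
  have Bn: "?B \<subseteq> irr" "?B \<in> sets borel"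
    using B by (auto intro: funpow_pre_borel dest: funpow_pre_subset[of B n])
  have RB: "R i \<inter> ?B \<subseteq> irr" "R i \<inter> ?B \<in> sets borel" for i using R Rm Bn by auto
  have QB_eq: "Q \<inter> (pre ^^ Suc n) B = (\<Union>i. branch (Suc i) (R i \<inter> ?B))"
    using cover in_Q QI by (auto simp: branch_eq[OF _ RB(1)] pre_def subset_eq)
  have det: "digit_determined n (R i)" for i
    unfolding digit_determined_def
  proof (intro conjI R ballI impI)
    fix x y assume xy: "x \<in> irr" "y \<in> irr" and dig: "\<forall>j<n. cf_digit (Suc j) x = cf_digit (Suc j) y"
      and x: "x \<in> R i"
    let ?x = "1 / (real (Suc i) + x)" and ?y = "1 / (real (Suc i) + y)"
    have "1 \<le> Suc i" by simp
    note ix = inverse_branch[OF this xy(1)] and iy = inverse_branch[OF this xy(2)]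
    have "cf_digit (Suc 0) ?x = cf_digit (Suc 0) ?y"
      by (simp only: cf_digit_Suc_0 ix(2) iy(2))
    then have "\<forall>j<Suc n. cf_digit (Suc j) ?x = cf_digit (Suc j) ?y"
      unfolding all_less_Suc_split cf_digit_Suc ix(3) iy(3) using dig by blast
    then have "?y \<in> Q"
      using Suc.prems(3) x ix(1) iy(1) unfolding digit_determined_def R_def by blast
    then show "y \<in> R i" using xy by (simp add: R_def)
  qed
  have a0: "0 \<le> a" using Suc.prems by simp
  have ai: "1 / (real (Suc i) + a) \<in> {0..1}" for i using a0 by (simp add: divide_simps)
  have s1: "(\<lambda>i. digit_prob (Suc i) a * nu (1 / (real (Suc i) + a)) (R i \<inter> ?B)) sums
      nu a (Q \<inter> (pre ^^ Suc n) B)"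
    unfolding QB_eq by (rule nu_branch_sums[OF a0 RB])
  have s2: "(\<lambda>i. M * (digit_prob (Suc i) a * nu (1 / (real (Suc i) + a)) (R i))) sums (M * nu a Q)"
    unfolding arg_cong[OF Q_eq, of "nu a"] by (intro sums_mult nu_branch_sums a0 R Rm)
  have le: "digit_prob (Suc i) a * nu (1 / (real (Suc i) + a)) (R i \<inter> ?B)
      \<le> M * (digit_prob (Suc i) a * nu (1 / (real (Suc i) + a)) (R i))" for i
    unfolding mult.left_commute[of M "digit_prob (Suc i) a"]
    by (intro mult_left_mono Suc.IH[OF ai Rm det] digit_prob_nonneg[OF a0])
  show ?case by (rule sums_le[OF le s1 s2])
qed

lemma ones_free_measure_submult:
  assumes "1 \<le> k"
  shows "ones_free_measure k (n + m) \<le> 2 * ones_free_measure k n * ones_free_measure k m"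
proof -
  let ?A = "no_ones_block_set k"
  note A = no_ones_block_set_subset[of k] no_ones_block_set_borel[OF assms]
  have "nu 0 (?A (n + m)) \<le> nu 0 (?A n \<inter> (pre ^^ n) (?A m))"
    unfolding nu_def using no_ones_block_set_antimono[of n "n + m" k] no_ones_block_set_add[of k n m] A
    by (intro weighted_mono weight_cyl_density sets.Int funpow_pre_borel) auto
  also have "\<dots> \<le> (2 * nu 0 (?A m)) * nu 0 (?A n)"
    by (intro nu_quasi_independent nu_le_nu_0 A digit_determined_no_ones_block_set) auto
  finally show ?thesis by (simp add: ones_free_measure_nu[OF assms] mult_ac)
qed

text \<open>
  Fekete's lemma in multiplicative form. Roots in place of logarithms include the case of limit 0.
\<close>
lemma convergent_root_submultiplicative:
  fixes m :: "nat \<Rightarrow> real"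
  assumes m: "\<And>n. 0 \<le> m n" "\<And>n. m n \<le> 1"
    and C: "1 \<le> C" and sub: "\<And>i j. m (i + j) \<le> C * m i * m j"
  shows "convergent (\<lambda>n. root n (m n))"
proof -
  define b where "b n = C * m n" for n
  have b0: "0 \<le> b n" for n using m C by (simp add: b_def)
  have bC: "b n \<le> C" for n using mult_left_mono[OF m(2)[of n], of C] C by (simp add: b_def)
  have b_sub: "b (i + j) \<le> b i * b j" for i j
    using mult_left_mono[OF sub, of C i j] C by (simp add: b_def mult_ac)
  have b_mult: "b (q * N + s) \<le> b N ^ q * b s" for q N s
  proof (induction q)
    case (Suc q)
    have "b (Suc q * N + s) \<le> b N * b (q * N + s)" using b_sub[of N "q * N + s"] by (simp add: add_ac)
    also have "\<dots> \<le> b N * (b N ^ q * b s)" by (intro mult_left_mono Suc b0)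
    finally show ?case by (simp add: mult_ac)
  qed simp
  define S where "S = (\<lambda>n. root n (b n)) ` {1..}"
  define l where "l = Inf S"
  have S: "S \<noteq> {}" "bdd_below S" using b0 by (auto simp: S_def intro!: bdd_belowI[of _ 0])
  have l0: "0 \<le> l" unfolding l_def using b0 S by (intro cInf_greatest) (auto simp: S_def)
  have l_le: "l \<le> root n (b n)" if "1 \<le> n" for n
    unfolding l_def using that S(2) by (intro cInf_lower) (auto simp: S_def)
  have "(\<lambda>n. root n (b n)) \<longlonglongrightarrow> l"
  proof (rule order_tendstoI)
    fix c assume "c < l"
    then show "\<forall>\<^sub>F n in sequentially. c < root n (b n)"
      using l_le by (intro eventually_sequentiallyI[of 1]) force
  next
    fix c assume "l < c"
    then obtain r where r: "l < r" "r < c" using dense by blast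
    then obtain N where N: "1 \<le> N" "root N (b N) < r"
      using cInf_lessD[OF S(1), of r] by (auto simp: l_def S_def)
    have r0: "0 < r" using l0 r by simp
    have bN: "b N \<le> r ^ N"
      using N power_mono[of "root N (b N)" r N] b0[of N] by simp
    \<comment> \<open>With \<open>n = q * N + s\<close> the remainder \<open>s\<close> costs a factor \<open>C / r ^ s\<close>; the minimum covers \<open>r > 1\<close>.\<close>
    define K where "K = C / min 1 r ^ N"
    have K: "0 < K" using C r0 by (simp add: K_def)
    have bound: "root n (b n) \<le> r * root n K" if n: "1 \<le> n" for n
    proof -
      define q s where "q = n div N" and "s = n mod N"
      have n_eq: "n = q * N + s" by (simp add: q_def s_def)
      have "s < N" using N by (simp add: s_def)
      have mr: "0 < min 1 r" "min 1 r \<le> 1" using r0 by auto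
      have "min 1 r ^ N \<le> min 1 r ^ s" using mr \<open>s < N\<close> by (intro power_decreasing) auto
      also have "\<dots> \<le> r ^ s" using mr by (intro power_mono) auto
      finally have rs: "min 1 r ^ N \<le> r ^ s" .
      have "b n \<le> (r ^ N) ^ q * C"
        unfolding n_eq using bN b0 bC r0 by (intro order_trans[OF b_mult] mult_mono power_mono) auto
      also have "\<dots> = r ^ n * (C / r ^ s)" using r0
        by (simp add: n_eq power_add power_mult[symmetric] mult.commute)
      also have "\<dots> \<le> r ^ n * K"
        unfolding K_def using rs r0 mr C by (intro mult_left_mono divide_left_mono) auto
      finally have "root n (b n) \<le> root n (r ^ n * K)" using n by simp
      also have "\<dots> = r * root n K" using n r0 by (simp add: real_root_mult real_root_power_cancel)
      finally show ?thesis .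
    qed
    have "(\<lambda>n. r * root n K) \<longlonglongrightarrow> r * 1" by (intro tendsto_mult_left LIMSEQ_root_const K)
    then have "\<forall>\<^sub>F n in sequentially. r * root n K < c"
      using r(2) by (intro order_tendstoD(2)) auto
    then show "\<forall>\<^sub>F n in sequentially. root n (b n) < c"
      using eventually_ge_at_top[of 1]
      by eventually_elim (use bound in \<open>blast intro: order_le_less_trans\<close>)
  qed
  moreover have "(\<lambda>n. root n C) \<longlonglongrightarrow> 1" using C by (intro LIMSEQ_root_const) auto
  ultimately have "(\<lambda>n. root n (b n) / root n C) \<longlonglongrightarrow> l / 1" by (intro tendsto_divide) auto
  moreover have "root n (b n) / root n C = root n (m n)" for n
    using C by (cases "n = 0") (auto simp: b_def real_root_mult)
  ultimately show ?thesis by (auto simp: convergent_def)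
qed

lemma convergent_ones_free_measure:
  assumes "1 \<le> k"
  shows "convergent (\<lambda>n. root n (ones_free_measure k n))"
proof (rule convergent_root_submultiplicative)
  fix n i j
  show "0 \<le> ones_free_measure k n" by (simp add: ones_free_measure_def)
  have "nu 0 (no_ones_block_set k n) \<le> nu 0 irr"
    unfolding nu_def by (intro weighted_mono weight_cyl_density no_ones_block_set_subset) auto
  then show "ones_free_measure k n \<le> 1" using assms by (simp add: ones_free_measure_nu nu_irr)
  show "ones_free_measure k (i + j) \<le> 2 * ones_free_measure k i * ones_free_measure k j"
    by (rule ones_free_measure_submult[OF assms])
qed simp

section \<open>The cylinder of ones\<close>

text \<open>
  The denominators of the convergents of a block of \<open>k\<close> digits 1 are Fibonacci numbers, so \<open>tail_param k\<close>
  is the parameter \<open>q'/q\<close> of this block and \<open>ones_length k\<close> is the length of its cylinder.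
\<close>
definition tail_param :: "nat \<Rightarrow> real" where
  "tail_param k = real (fib k) / real (fib (Suc k))"

definition ones_length :: "nat \<Rightarrow> real" where
  "ones_length k = 1 / (real (fib (Suc k)) * real (fib (Suc (Suc k))))"

lemma tail_param_bounds: "tail_param k \<in> {0..1}"
  using fib_Suc_mono[of k] fib_neq_0_nat[of "Suc k"] by (simp add: tail_param_def)

lemma ones_length_pos: "0 < ones_length k"
  using fib_neq_0_nat[of "Suc k"] fib_neq_0_nat[of "Suc (Suc k)"]
  by (simp add: ones_length_def del: fib.simps)

lemma nu_0_funpow_branch:
  assumes "B \<subseteq> irr" "B \<in> sets borel"
  shows "nu 0 ((branch (Suc 0) ^^ k) B) = ones_length k * nu (tail_param k) B"
  using assms
proof (induction k arbitrary: B)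
  case 0
  then show ?case by (simp add: ones_length_def tail_param_def)
next
  case (Suc k)
  define f g where "f = real (fib k)" and "g = real (fib (Suc k))"
  have fg: "0 \<le> f" "0 < g" using fib_neq_0_nat[of "Suc k"] by (simp_all add: f_def g_def)
  have fibs: "real (fib (Suc (Suc k))) = f + g" "real (fib (Suc (Suc (Suc k)))) = f + g + g"
    by (simp_all add: f_def g_def)
  have "nu 0 ((branch (Suc 0) ^^ Suc k) B) = nu 0 ((branch (Suc 0) ^^ k) (branch (Suc 0) B))"
    by (simp only: funpow_Suc_right o_apply)
  also have "\<dots> = ones_length k * nu (tail_param k) (branch (Suc 0) B)"
    using Suc.prems by (intro Suc.IH branch_subset branch_borel) auto
  also have "\<dots> = ones_length k * (digit_prob (Suc 0) (tail_param k) * nu (1 / (real (Suc 0) + tail_param k)) B)"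
    using Suc.prems tail_param_bounds[of k] by (subst nu_branch) auto
  also have "1 / (real (Suc 0) + tail_param k) = tail_param (Suc k)"
    using fg unfolding tail_param_def fibs f_def[symmetric] g_def[symmetric]
    by (simp add: divide_simps)
  also have "ones_length k * (digit_prob (Suc 0) (tail_param k) * nu (tail_param (Suc k)) B)
      = (ones_length k * digit_prob (Suc 0) (tail_param k)) * nu (tail_param (Suc k)) B"
    by simp
  also have "ones_length k * digit_prob (Suc 0) (tail_param k) = ones_length (Suc k)"
  proof -
    have "1 + f / g = (f + g) / g" "1 + 1 + f / g = (f + g + g) / g"
      using fg by (simp_all add: field_simps)
    then show ?thesis
      using fg unfolding ones_length_def digit_prob_def tail_param_def fibs f_def[symmetric] g_def[symmetric]
      by simp
  qed
  finally show ?case .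
qed

section \<open>Survival probabilities under the Gauss measure\<close>

lemma ln2_bounds: "1 / 2 \<le> ln (2::real)" "ln (2::real) \<le> 1"
  using ln2_ge_two_thirds ln_2_less_1 by auto

lemma mu_le_nu_0:
  assumes "B \<subseteq> irr" "B \<in> sets borel"
  shows "mu B \<le> 2 * nu 0 B"
  unfolding mu_def nu_def
proof (intro weighted_le weight_cyl_density weight_gauss_density)
  fix y assume "y \<in> B"
  then have "1 * (1 / 2) \<le> (1 + y) * ln 2"
    using assms irr_bounds[of y] ln2_bounds by (intro mult_mono) auto
  then have "1 / ((1 + y) * ln 2) \<le> 1 / (1 / 2)" by (intro divide_left_mono) auto
  then show "gauss_density y \<le> 2 * cyl_density 0 y" by (simp add: cyl_density_def gauss_density_def)
qed (use assms irr_subset in auto)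

lemma nu_le_mu:
  assumes "B \<subseteq> irr" "B \<in> sets borel" "a \<in> {0..1}"
  shows "nu a B \<le> 4 * mu B"
proof -
  have "nu 0 B \<le> 2 * mu B"
    unfolding mu_def nu_def
  proof (intro weighted_le weight_cyl_density weight_gauss_density)
    fix y assume "y \<in> B"
    then have y: "0 < y" "y < 1" using assms irr_bounds[of y] by auto
    then have "(1 + y) * ln 2 \<le> 2 * 1" using ln2_bounds by (intro mult_mono) auto
    then have "1 / 2 \<le> 1 / ((1 + y) * ln 2)" using y by (intro divide_left_mono) auto
    then show "cyl_density 0 y \<le> 2 * gauss_density y" by (simp add: cyl_density_def gauss_density_def)
  qed (use assms irr_subset in auto)
  then show ?thesis using nu_le_nu_0[OF assms] by simp
qed

lemma mu_mono: "A \<in> sets borel \<Longrightarrow> B \<subseteq> A \<Longrightarrow> mu B \<le> mu A"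
  unfolding mu_def by (rule weighted_mono[OF weight_gauss_density])

lemma mu_Diff: "A \<in> sets borel \<Longrightarrow> B \<in> sets borel \<Longrightarrow> B \<subseteq> A \<Longrightarrow> mu (A - B) = mu A - mu B"
  unfolding mu_def by (rule weighted_Diff[OF weight_gauss_density])

lemma nu_mono: "0 \<le> a \<Longrightarrow> A \<in> sets borel \<Longrightarrow> B \<subseteq> A \<Longrightarrow> nu a B \<le> nu a A"
  unfolding nu_def by (rule weighted_mono[OF weight_cyl_density])

lemma nu_Diff:
  "0 \<le> a \<Longrightarrow> A \<in> sets borel \<Longrightarrow> B \<in> sets borel \<Longrightarrow> B \<subseteq> A \<Longrightarrow> nu a (A - B) = nu a A - nu a B"
  unfolding nu_def by (rule weighted_Diff[OF weight_cyl_density])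

lemma mu_nonneg: "0 \<le> mu B" and nu_nonneg: "0 \<le> nu a B"
  by (simp_all add: mu_def nu_def)

lemma mu_funpow_pre: "B \<subseteq> irr \<Longrightarrow> B \<in> sets borel \<Longrightarrow> mu ((pre ^^ m) B) = mu B"
  by (induction m) (simp_all add: mu_pre funpow_pre_subset funpow_pre_borel)

text \<open>
  The Gauss measure is used in place of Lebesgue measure since its invariance makes consecutive
  values comparable; the two measures agree up to constant factors, so the decay rate is the same.
\<close>
definition survival :: "nat \<Rightarrow> nat \<Rightarrow> real" where
  "survival k n = mu (no_ones_block_set k n)"

lemma ones_borel: "ones k \<in> sets borel" and ones_subset: "ones k \<subseteq> irr"
  unfolding ones_def by (simp_all add: funpow_branch_borel funpow_branch_subset irr_borel)

text \<open>
  Deleting the first digit preserves the measure, so passing from \<open>n\<close> to \<open>n + 1\<close> digits loses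
  only the points whose first block sits at the very beginning.
\<close>
lemma survival_Suc:
  assumes k: "1 \<le> k"
  shows "survival k n - survival k (Suc n) =
    (if k \<le> Suc n then mu (ones k \<inter> pre (no_ones_block_set k n)) else 0)"
proof -
  let ?A = "no_ones_block_set k"
  note A = no_ones_block_set_subset[of k] no_ones_block_set_borel[OF k]
  have "survival k n - survival k (Suc n) = mu (pre (?A n)) - mu (?A (Suc n))"
    by (simp add: survival_def mu_pre A)
  also have "\<dots> = mu (pre (?A n) - ?A (Suc n))"
    by (intro mu_Diff[symmetric] pre_borel A) (auto simp: no_ones_block_set_Suc)
  also have "pre (?A n) - ?A (Suc n) = (if k \<le> Suc n then ones k \<inter> pre (?A n) else {})"
    by (auto simp: no_ones_block_set_Suc)
  finally show ?thesis by (simp add: mu_def)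
qed

lemma survival_antimono:
  assumes "1 \<le> k" "m \<le> n"
  shows "survival k n \<le> survival k m"
  unfolding survival_def
  using assms by (intro mu_mono no_ones_block_set_borel no_ones_block_set_antimono)

lemma mu_funpow_branch_le:
  assumes "B \<subseteq> irr" "B \<in> sets borel"
  shows "mu ((branch (Suc 0) ^^ k) B) \<le> 8 * ones_length k * mu B"
proof -
  have "mu ((branch (Suc 0) ^^ k) B) \<le> 2 * (ones_length k * nu (tail_param k) B)"
    using mu_le_nu_0[of "(branch (Suc 0) ^^ k) B"] assms
    by (simp add: nu_0_funpow_branch funpow_branch_subset funpow_branch_borel)
  also have "\<dots> \<le> 2 * (ones_length k * (4 * mu B))"
    using nu_le_mu[OF assms tail_param_bounds[of k]] ones_length_pos[of k] by simp
  finally show ?thesis by simp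
qed

text \<open>
  A crude bound. If \<open>n = k - 1\<close>, the truncated difference \<open>n - k\<close> is 0, which is the right index
  there.
\<close>
lemma survival_drop_le:
  assumes k: "1 \<le> k"
  shows "survival k n - survival k (Suc n) \<le> 8 * ones_length k * survival k (n - k)"
proof -
  let ?A = "no_ones_block_set k"
  note A = no_ones_block_set_subset[of k] no_ones_block_set_borel[OF k]
  consider "Suc n < k" | "Suc n = k" | "k \<le> n" by linarith
  then show ?thesis
  proof cases
    case 1
    then show ?thesis using survival_Suc[OF k, of n] ones_length_pos[of k]
      by (simp add: survival_def mu_nonneg)
  next
    case 2
    then have "survival k n - survival k (Suc n) \<le> mu (ones k)"
      using survival_Suc[OF k, of n] by (simp add: mu_mono ones_borel)
    also have "\<dots> \<le> 8 * ones_length k * mu irr"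
      unfolding ones_def by (rule mu_funpow_branch_le) (auto simp: irr_borel)
    finally show ?thesis using 2 k by (simp add: survival_def no_ones_block_set_0)
  next
    case 3
    then have n: "n = (n - k) + k" by simp
    let ?D = "pre (?A (n - k)) - branch (Suc 0) (?A (n - k))"
    have D: "?D \<subseteq> irr" "?D \<in> sets borel"
      using pre_subset pre_borel[OF A(2)] branch_borel[of "Suc 0", OF _ A] by auto
    have "survival k n - survival k (Suc n) = mu (ones k \<inter> pre (?A ((n - k) + k)))"
      using survival_Suc[OF k, of n] 3 by simp
    also have "\<dots> \<le> 8 * ones_length k * mu ?D"
      unfolding first_block_removal[OF k] by (rule mu_funpow_branch_le[OF D])
    also have "mu ?D \<le> mu (pre (?A (n - k)))" by (intro mu_mono pre_borel A) auto
    also have "\<dots> = survival k (n - k)" by (simp add: survival_def mu_pre A)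
    finally show ?thesis using ones_length_pos[of k] by simp
  qed
qed

text \<open>
  The crude bound compares with \<open>n - k\<close> instead of \<open>n\<close>. By induction the survival probability
  loses at most a factor 2 over \<open>k\<close> steps, so replacing \<open>n - k\<close> by \<open>n\<close> costs a factor 2 only.
\<close>
lemma survival_Suc_ge:
  assumes k: "1 \<le> k" and small: "real k * (16 * ones_length k) \<le> 1 / 2"
  shows "(1 - 16 * ones_length k) * survival k n \<le> survival k (Suc n)"
proof (induction n rule: less_induct)
  case (less n)
  let ?e = "16 * ones_length k"
  have e0: "0 < ?e" using ones_length_pos by simp
  have e1: "?e \<le> 1 / 2"
  proof -
    have "1 * ?e \<le> real k * ?e" using k e0 by (intro mult_right_mono) auto
    then show ?thesis using small by linarith
  qed
  define m where "m = n - k"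
  have "(1 - ?e) ^ j * survival k m \<le> survival k (m + j)" if "m + j \<le> n" for j
    using that
  proof (induction j)
    case (Suc j)
    have "(1 - ?e) ^ Suc j * survival k m \<le> (1 - ?e) * survival k (m + j)"
      using Suc e1 by (simp add: mult.assoc mult_left_mono)
    also have "\<dots> \<le> survival k (m + Suc j)" using less[of "m + j"] Suc.prems by simp
    finally show ?case .
  qed simp
  from this[of "n - m"] have "(1 - ?e) ^ (n - m) * survival k m \<le> survival k n"
    by (simp add: m_def)
  moreover have "1 / 2 \<le> (1 - ?e) ^ (n - m)"
  proof -
    have "real (n - m) * ?e \<le> real k * ?e" using e0 by (intro mult_right_mono) (auto simp: m_def)
    then have "1 / 2 \<le> 1 + real (n - m) * (- ?e)" using small by simp
    also have "\<dots> \<le> (1 + (- ?e)) ^ (n - m)" using e1 by (intro Bernoulli_inequality) simp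
    finally show ?thesis by simp
  qed
  ultimately have "1 / 2 * survival k m \<le> survival k n"
    using mult_right_mono[of "1/2" "(1 - ?e) ^ (n - m)" "survival k m"]
    by (simp add: survival_def mu_nonneg)
  then have "8 * ones_length k * survival k m \<le> ?e * survival k n"
    using mult_left_mono[of "1 / 2 * survival k m" "survival k n" ?e] e0 by simp
  then show ?case using survival_drop_le[OF k, of n] by (simp add: m_def algebra_simps)
qed

lemma survival_add_ge:
  assumes k: "1 \<le> k" and small: "real k * (16 * ones_length k) \<le> 1 / 2"
  shows "(1 - real j * (16 * ones_length k)) * survival k m \<le> survival k (m + j)"
    and "0 < survival k n"
proof -
  let ?e = "16 * ones_length k"
  have e0: "0 < ?e" using ones_length_pos by simp
  have e1: "?e \<le> 1 / 2"
  proof -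
    have "1 * ?e \<le> real k * ?e" using k e0 by (intro mult_right_mono) auto
    then show ?thesis using small by linarith
  qed
  have pow: "(1 - ?e) ^ j * survival k m \<le> survival k (m + j)" for j m
  proof (induction j)
    case (Suc j)
    have "(1 - ?e) ^ Suc j * survival k m \<le> (1 - ?e) * survival k (m + j)"
      using Suc e1 by (simp add: mult.assoc mult_left_mono)
    also have "\<dots> \<le> survival k (m + Suc j)" using survival_Suc_ge[OF assms, of "m + j"] by simp
    finally show ?case .
  qed simp
  have "1 + real j * (- ?e) \<le> (1 + (- ?e)) ^ j" using e1 by (intro Bernoulli_inequality) simp
  then have "(1 - real j * ?e) * survival k m \<le> (1 - ?e) ^ j * survival k m"
    by (intro mult_right_mono) (simp_all add: survival_def mu_nonneg)
  then show "(1 - real j * ?e) * survival k m \<le> survival k (m + j)" using pow[of j m] by simp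
  have "1 \<le> 4 * mu irr" using nu_le_mu[of irr 0] nu_irr[of 0] by (simp add: irr_borel)
  then have "0 < (1 - ?e) ^ n * survival k 0"
    using e1 k by (intro mult_pos_pos) (auto simp: survival_def no_ones_block_set_0)
  then show "0 < survival k n" using pow[of n 0] by simp
qed

section \<open>The mass lost in one step\<close>

text \<open>
  Two errors are added. Over a window of \<open>2 k\<close> digits the survival probability changes by at most the
  factor \<open>q\<close>; this is what it costs to ignore blocks inside the window. The power of \<open>65/72\<close> is the
  loss of memory over \<open>k\<close> digits. Letting the gap grow with \<open>k\<close> makes both vanish in a single limit.
\<close>
definition mixing_error :: "nat \<Rightarrow> real" where
  "mixing_error k = (let q = 1 / (1 - 2 * real k * (16 * ones_length k))
     in 5 * (q - 1) + 16 * (q * (65 / 72) ^ k))"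

text \<open>
  The event is enlarged to one that does not look at its first \<open>j\<close> digits. The enlarged event has
  nearly the same probability under all \<open>nu a\<close> as under the Gauss measure, and what was added is small
  because \<open>nu a\<close> is at most 4 times the Gauss measure, for which the added mass is a difference
  of survival probabilities.
\<close>
lemma nu_survival_approx:
  assumes k: "1 \<le> k" and small: "2 * real k * (16 * ones_length k) \<le> 1 / 2"
    and S: "S \<subseteq> (pre ^^ j) (no_ones_block_set k i)" "S \<in> sets borel" "k \<le> j"
    and mu_S: "mu S = survival k (i + k)" and a: "a \<in> {0..1}"
  shows "\<bar>nu a S - survival k (i + 2 * k)\<bar> \<le> mixing_error k * survival k (i + 2 * k)"
proof -
  let ?A = "no_ones_block_set k i"
  let ?T = "(pre ^^ j) ?A"
  note A = no_ones_block_set_subset[of k i] no_ones_block_set_borel[OF k, of i]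
  have T: "?T \<subseteq> irr" "?T \<in> sets borel"
    using A by (auto intro: funpow_pre_borel dest: funpow_pre_subset[of ?A j])
  define q where "q = 1 / (1 - 2 * real k * (16 * ones_length k))"
  define p where "p = survival k (i + 2 * k)"
  define p0 where "p0 = survival k i"
  define t :: real where "t = (65 / 72) ^ k"
  have t0: "0 \<le> t" by (simp add: t_def)
  have small': "real k * (16 * ones_length k) \<le> 1 / 2"
    using small ones_length_pos[of k] mult_nonneg_nonneg[of "real k" "ones_length k"] by simp
  have p: "0 < p" unfolding p_def by (rule survival_add_ge(2)[OF k small'])
  have "(1 - real (2 * k) * (16 * ones_length k)) * p0 \<le> p"
    unfolding p_def p0_def by (rule survival_add_ge(1)[OF k small'])
  then have p0_le: "p0 \<le> q * p"
    using small by (simp add: q_def field_simps)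
  have p_le: "p \<le> survival k (i + k)" "p \<le> p0"
    unfolding p_def p0_def by (intro survival_antimono[OF k]; simp)+
  have "\<bar>nu a ?T - mu ?T\<bar> \<le> (65 / 72) ^ j * (4 * nu 0 ?A)" by (rule nu_pre_mu[OF A a])
  also have "\<dots> \<le> t * (4 * (4 * mu ?A))"
    unfolding t_def using nu_le_mu[OF A, of 0] S(3)
    by (intro mult_mono power_decreasing) (auto simp: nu_nonneg)
  finally have near: "\<bar>nu a ?T - p0\<bar> \<le> 16 * (t * p0)"
    by (simp add: mu_funpow_pre[OF A] p0_def survival_def)
  have tp0: "t * p0 \<le> t * (q * p)" using p0_le t0 by (rule mult_left_mono)
  have "nu a ?T - nu a S = nu a (?T - S)"
    using S T a by (intro nu_Diff[symmetric]) auto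
  also have "\<dots> \<le> 4 * mu (?T - S)" using S T a by (intro nu_le_mu) auto
  also have "mu (?T - S) = p0 - survival k (i + k)"
    using S T by (simp add: mu_Diff mu_funpow_pre[OF A] mu_S p0_def survival_def)
  finally have lower: "nu a ?T - nu a S \<le> 4 * (p0 - p)" using p_le by simp
  have upper: "nu a S \<le> nu a ?T" using S T a by (intro nu_mono) auto
  have me: "mixing_error k = 5 * (q - 1) + 16 * (q * t)"
    by (simp only: mixing_error_def Let_def q_def t_def)
  have "mixing_error k * p = 5 * (q * p - p) + 16 * (t * (q * p))"
    unfolding me by (simp add: algebra_simps)
  then show ?thesis
    unfolding p_def[symmetric] using near tp0 lower upper p0_le p_le by (auto simp: abs_le_iff)
qed

text \<open>
  After the \<open>k\<close> digits 1 the remainder is governed by the parameter \<open>tail_param k\<close>. Up to the mixing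
  error, the digit after the block is independent of what follows, and \<open>1 / (2 + a)\<close> is the probability
  that it is another 1.
\<close>
lemma nu_0_first_block:
  assumes k: "1 \<le> k" and small: "2 * real k * (16 * ones_length k) \<le> 1 / 2"
    and n: "2 * k \<le> n"
  shows "\<bar>nu 0 (ones k \<inter> pre (no_ones_block_set k n))
      - ones_length k * ((1 - 1 / (2 + tail_param k)) * survival k n)\<bar>
    \<le> ones_length k * (2 * mixing_error k * survival k n)"
proof -
  obtain i where i: "n = i + 2 * k" using n by (metis add.commute le_Suc_ex)
  let ?B = "no_ones_block_set k (i + k)"
  let ?a = "tail_param k"
  define p where "p = survival k n"
  define e where "e = mixing_error k"
  define c where "c = 1 / (2 + ?a)"
  note B = no_ones_block_set_subset[of k "i + k"] no_ones_block_set_borel[OF k, of "i + k"]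
  have a: "?a \<in> {0..1}" by (rule tail_param_bounds)
  have c: "0 \<le> c" "c \<le> 1" using a by (auto simp: c_def)
  have sub: "?B \<subseteq> (pre ^^ k) (no_ones_block_set k i)"
    using no_ones_block_set_add[of k k i] by (simp add: add.commute)
  have 1: "\<bar>nu ?a (pre ?B) - p\<bar> \<le> e * p"
    unfolding p_def e_def i
    using a B sub pre_mono[OF sub]
    by (intro nu_survival_approx[OF k small, where j = "Suc k"]) (auto simp: pre_borel mu_pre survival_def)
  have 2: "\<bar>nu (1 / (1 + ?a)) ?B - p\<bar> \<le> e * p"
    unfolding p_def e_def i
    using a B sub
    by (intro nu_survival_approx[OF k small, where j = k]) (auto simp: survival_def)
  let ?D = "pre ?B - branch (Suc 0) ?B"
  have br: "branch (Suc 0) ?B \<subseteq> pre ?B" "branch (Suc 0) ?B \<in> sets borel"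
    using pre_eq_UN_branch[OF B(1)] branch_borel[of "Suc 0", OF _ B] by auto
  have D: "?D \<subseteq> irr" "?D \<in> sets borel"
    using br pre_subset pre_borel[OF B(2)] by auto
  have "n = (i + k) + k" by (simp add: i)
  then have "ones k \<inter> pre (no_ones_block_set k n) = (branch (Suc 0) ^^ k) ?D"
    using first_block_removal[OF k, of "i + k"] by simp
  then have "nu 0 (ones k \<inter> pre (no_ones_block_set k n)) = ones_length k * nu ?a ?D"
    by (simp add: nu_0_funpow_branch[OF D])
  also have "nu ?a ?D = nu ?a (pre ?B) - nu ?a (branch (Suc 0) ?B)"
    using a br B by (intro nu_Diff pre_borel) auto
  also have "nu ?a (branch (Suc 0) ?B) = c * nu (1 / (1 + ?a)) ?B"
  proof -
    have "digit_prob (Suc 0) ?a = c"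
      using a by (simp add: digit_prob_def c_def)
    then show ?thesis using nu_branch[of ?a "Suc 0" ?B] a B by simp
  qed
  finally have eq: "nu 0 (ones k \<inter> pre (no_ones_block_set k n))
      = ones_length k * (nu ?a (pre ?B) - c * nu (1 / (1 + ?a)) ?B)" .
  have "\<bar>c * (nu (1 / (1 + ?a)) ?B - p)\<bar> \<le> 1 * (e * p)"
    unfolding abs_mult using 2 c by (intro mult_mono) auto
  then have "\<bar>(nu ?a (pre ?B) - c * nu (1 / (1 + ?a)) ?B) - (1 - c) * p\<bar> \<le> 2 * e * p"
    using 1 by (simp add: abs_le_iff algebra_simps)
  then have "ones_length k * \<bar>(nu ?a (pre ?B) - c * nu (1 / (1 + ?a)) ?B) - (1 - c) * p\<bar>
      \<le> ones_length k * (2 * e * p)"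
    using ones_length_pos[of k] by (intro mult_left_mono) auto
  moreover have "\<bar>ones_length k * x - ones_length k * y\<bar> = ones_length k * \<bar>x - y\<bar>" for x y
    using ones_length_pos[of k] by (simp add: right_diff_distrib[symmetric] abs_mult)
  ultimately show ?thesis unfolding eq p_def e_def c_def by simp
qed

section \<open>The golden point and bounds for the decay rate\<close>

definition golden :: real where
  "golden = (sqrt 5 - 1) / 2"

lemma golden_bounds: "0 < golden" "golden < 1"
proof -
  have "1 < sqrt 5" by simp
  then show "0 < golden" by (simp add: golden_def)
  have "sqrt 5 < 3" by (rule real_less_lsqrt) auto
  then show "golden < 1" by (simp add: golden_def)
qed

lemma golden_square: "golden\<^sup>2 = 1 - golden"
  by (simp add: golden_def power2_eq_square field_simps)

lemma golden_fixed: "1 / (1 + golden) = golden"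
  using golden_bounds golden_square by (simp add: divide_simps power2_eq_square algebra_simps)

text \<open>
  The inverse branch of the digit 1 has the golden point as its fixed point and contracts distances to
  it by the factor \<open>1 / (1 + golden) = golden\<close>.
\<close>
lemma ones_near_golden: "x \<in> ones k \<Longrightarrow> \<bar>x - golden\<bar> \<le> golden ^ k"
proof (induction k arbitrary: x)
  case 0
  then show ?case using irr_bounds[of x] golden_bounds by (auto simp: ones_def)
next
  case (Suc k)
  then obtain y where y: "y \<in> ones k" "x = 1 / (1 + y)"
    by (auto simp: ones_def branch_def)
  have y0: "0 < y" using y ones_subset[of k] irr_bounds by auto
  have "\<bar>x - golden\<bar> = \<bar>1 / (1 + y) - 1 / (1 + golden)\<bar>" by (simp only: y golden_fixed)
  also have "\<dots> = \<bar>y - golden\<bar> / ((1 + y) * (1 + golden))"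
    using y0 golden_bounds by (intro inverse_diff_abs) auto
  also have "\<dots> \<le> \<bar>y - golden\<bar> / (1 * (1 + golden))"
    using y0 golden_bounds by (intro divide_left_mono mult_right_mono) auto
  also have "\<dots> = \<bar>y - golden\<bar> * golden"
    by (simp only: divide_inverse mult_1 golden_fixed[unfolded divide_inverse mult_1])
  also have "\<dots> \<le> golden ^ k * golden"
    using Suc.IH[OF y(1)] golden_bounds by (intro mult_right_mono) auto
  finally show ?case by (simp add: mult.commute)
qed

text \<open>
  Close to the golden point the Gauss density is nearly constant.
\<close>
lemma mu_ones_bounds:
  assumes B: "B \<subseteq> ones k" "B \<in> sets borel" and k: "1 \<le> k"
  shows "nu 0 B / ((1 + golden + golden ^ k) * ln 2) \<le> mu B"
    and "mu B \<le> nu 0 B / ((1 + golden - golden ^ k) * ln 2)"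
proof -
  have BI: "B \<subseteq> {0..1}" using B ones_subset irr_subset by blast
  have g: "0 < golden ^ k" "golden ^ k \<le> 1" using golden_bounds by (auto simp: power_le_one)
  have l2: "0 < ln (2::real)" by simp
  have near: "golden - golden ^ k \<le> y" "y \<le> golden + golden ^ k" "0 < y" if "y \<in> B" for y
    using ones_near_golden[of y k] that B ones_subset[of k] irr_bounds[of y] by (auto simp: abs_le_iff)
  have "nu 0 B \<le> ((1 + golden + golden ^ k) * ln 2) * mu B"
    unfolding mu_def nu_def
  proof (intro weighted_le weight_cyl_density weight_gauss_density B BI)
    fix y assume "y \<in> B"
    note y = near[OF this]
    have "(1 + y) * ln 2 \<le> (1 + golden + golden ^ k) * ln 2"
      using y l2 by (intro mult_right_mono) auto
    then show "cyl_density 0 y \<le> ((1 + golden + golden ^ k) * ln 2) * gauss_density y"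
      using y(3) by (simp add: cyl_density_def gauss_density_def)
  qed simp
  moreover have "0 < (1 + golden + golden ^ k) * ln 2"
    using g golden_bounds by (intro mult_pos_pos l2) linarith
  ultimately show "nu 0 B / ((1 + golden + golden ^ k) * ln 2) \<le> mu B"
    by (simp only: pos_divide_le_eq mult.commute)
  have "mu B \<le> (1 / ((1 + golden - golden ^ k) * ln 2)) * nu 0 B"
    unfolding mu_def nu_def
  proof (intro weighted_le weight_cyl_density weight_gauss_density B BI)
    fix y assume "y \<in> B"
    note y = near[OF this]
    have "(1 + golden - golden ^ k) * ln 2 \<le> (1 + y) * ln 2"
      using y l2 by (intro mult_right_mono) auto
    moreover have "0 < (1 + golden - golden ^ k) * ln 2"
      using g golden_bounds l2 by (intro mult_pos_pos) auto
    ultimately have "1 / ((1 + y) * ln 2) \<le> 1 / ((1 + golden - golden ^ k) * ln 2)"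
      by (intro frac_le order_refl zero_le_one)
    then show "gauss_density y \<le> 1 / ((1 + golden - golden ^ k) * ln 2) * cyl_density 0 y"
      by (simp add: cyl_density_def gauss_density_def)
  qed simp
  then show "mu B \<le> nu 0 B / ((1 + golden - golden ^ k) * ln 2)" by simp
qed

definition lower_rate :: "nat \<Rightarrow> real" where
  "lower_rate k = ones_length k * (1 - 1 / (2 + tail_param k) - 2 * mixing_error k)
     / ((1 + golden + golden ^ k) * ln 2)"

definition upper_rate :: "nat \<Rightarrow> real" where
  "upper_rate k = ones_length k * (1 - 1 / (2 + tail_param k) + 2 * mixing_error k)
     / ((1 + golden - golden ^ k) * ln 2)"

lemma survival_ratio_bounds:
  assumes k: "1 \<le> k" and small: "2 * real k * (16 * ones_length k) \<le> 1 / 2"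
    and n: "2 * k \<le> n"
  shows "(1 - upper_rate k) * survival k n \<le> survival k (Suc n)"
    and "survival k (Suc n) \<le> (1 - lower_rate k) * survival k n"
proof -
  let ?E = "ones k \<inter> pre (no_ones_block_set k n)"
  define c where "c = 1 / (2 + tail_param k)"
  define e where "e = mixing_error k"
  define L where "L = ones_length k"
  define p where "p = survival k n"
  have g: "0 < golden ^ k" "golden ^ k \<le> 1" using golden_bounds by (auto simp: power_le_one)
  have E: "?E \<subseteq> ones k" "?E \<in> sets borel"
    using ones_borel pre_borel[OF no_ones_block_set_borel[OF k]] by auto
  have drop: "p - survival k (Suc n) = mu ?E"
    using survival_Suc[OF k, of n] n by (simp add: p_def)
  have "\<bar>nu 0 ?E - L * ((1 - c) * p)\<bar> \<le> L * (2 * e * p)"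
    unfolding L_def c_def e_def p_def by (rule nu_0_first_block[OF assms])
  then have nuE: "L * (1 - c - 2 * e) * p \<le> nu 0 ?E" "nu 0 ?E \<le> L * (1 - c + 2 * e) * p"
    by (simp_all add: abs_le_iff algebra_simps)
  have "upper_rate k * p = L * (1 - c + 2 * e) * p / ((1 + golden - golden ^ k) * ln 2)"
    by (simp add: upper_rate_def L_def c_def e_def)
  also have "\<dots> \<ge> nu 0 ?E / ((1 + golden - golden ^ k) * ln 2)"
    using g golden_bounds by (intro divide_right_mono nuE) auto
  finally have "mu ?E \<le> upper_rate k * p" using mu_ones_bounds(2)[OF E k] by simp
  then show "(1 - upper_rate k) * survival k n \<le> survival k (Suc n)"
    using drop by (simp add: p_def[symmetric] algebra_simps)
  have "lower_rate k * p = L * (1 - c - 2 * e) * p / ((1 + golden + golden ^ k) * ln 2)"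
    by (simp add: lower_rate_def L_def c_def e_def)
  also have "\<dots> \<le> nu 0 ?E / ((1 + golden + golden ^ k) * ln 2)"
    using g golden_bounds by (intro divide_right_mono nuE) auto
  finally have "lower_rate k * p \<le> mu ?E" using mu_ones_bounds(1)[OF E k] by simp
  then show "survival k (Suc n) \<le> (1 - lower_rate k) * survival k n"
    using drop by (simp add: p_def[symmetric] algebra_simps)
qed

lemma root_limit_le:
  assumes lim: "(\<lambda>n. root n (m n)) \<longlonglongrightarrow> l" and r: "0 \<le> r" and K: "0 < K"
    and le: "\<And>n. N \<le> n \<Longrightarrow> m n \<le> K * r ^ n"
  shows "l \<le> r"
proof -
  have "(\<lambda>n. root n K * r) \<longlonglongrightarrow> 1 * r" by (intro tendsto_mult_right LIMSEQ_root_const K)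
  then have "(\<lambda>n. root n K * r) \<longlonglongrightarrow> r" by simp
  moreover have "root n (m n) \<le> root n K * r" if "max 1 N \<le> n" for n
  proof -
    have "root n (m n) \<le> root n (K * r ^ n)" using le that by simp
    also have "\<dots> = root n K * r" using that r by (simp add: real_root_mult real_root_power_cancel)
    finally show ?thesis .
  qed
  ultimately show ?thesis using LIMSEQ_le[OF lim] by blast
qed

lemma root_limit_ge:
  assumes lim: "(\<lambda>n. root n (m n)) \<longlonglongrightarrow> l" and r: "0 \<le> r" and K: "0 < K"
    and le: "\<And>n. N \<le> n \<Longrightarrow> K * r ^ n \<le> m n"
  shows "r \<le> l"
proof -
  have "(\<lambda>n. root n K * r) \<longlonglongrightarrow> 1 * r" by (intro tendsto_mult_right LIMSEQ_root_const K)
  then have "(\<lambda>n. root n K * r) \<longlonglongrightarrow> r" by simp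
  moreover have "root n K * r \<le> root n (m n)" if "max 1 N \<le> n" for n
  proof -
    have "root n K * r = root n (K * r ^ n)" using that r by (simp add: real_root_mult real_root_power_cancel)
    also have "\<dots> \<le> root n (m n)" using le that by simp
    finally show ?thesis .
  qed
  ultimately show ?thesis using LIMSEQ_le[OF _ lim] by blast
qed

text \<open>
  The survival probability loses a fraction between the two rates at each step from \<open>2 k\<close> on, so
  its \<open>n\<close>-th roots inherit the bounds; the constant factors disappear under the roots.
\<close>
lemma decay_rate_bounds:
  assumes k: "1 \<le> k" and small: "2 * real k * (16 * ones_length k) \<le> 1 / 2"
  shows "lower_rate k \<le> 1 - decay_rate k" "1 - decay_rate k \<le> upper_rate k"
proof -
  define m where "m n = ones_free_measure k n" for n
  define N where "N = 2 * k"
  have small': "real k * (16 * ones_length k) \<le> 1 / 2"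
    using small ones_length_pos[of k] mult_nonneg_nonneg[of "real k" "ones_length k"] by simp
  note pos = survival_add_ge(2)[OF k small']
  have lim: "(\<lambda>n. root n (m n)) \<longlonglongrightarrow> decay_rate k"
    using convergent_ones_free_measure[OF k] by (simp add: decay_rate_def m_def convergent_LIMSEQ_iff)
  note A = no_ones_block_set_subset[of k] no_ones_block_set_borel[OF k]
  have m_le: "m n \<le> 4 * survival k n" for n
    using nu_le_mu[OF A, of 0] by (simp add: m_def ones_free_measure_nu[OF k] survival_def)
  have m_ge: "1 / 2 * survival k n \<le> m n" for n
    using mu_le_nu_0[OF A, of n] by (simp add: m_def ones_free_measure_nu[OF k] survival_def)
  define l u where "l = 1 - lower_rate k" and "u = 1 - upper_rate k"
  have l_pos: "0 < l"
  proof -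
    have "survival k (Suc N) \<le> l * survival k N"
      unfolding l_def by (rule survival_ratio_bounds(2)[OF k small]) (simp add: N_def)
    then have "0 < l * survival k N" using pos[of "Suc N"] by linarith
    then show ?thesis using pos[of N] by (rule zero_less_mult_pos2)
  qed
  have up: "survival k (N + j) \<le> survival k N * l ^ j" for j
  proof (induction j)
    case (Suc j)
    have "survival k (N + Suc j) \<le> l * survival k (N + j)"
      using survival_ratio_bounds(2)[OF k small, of "N + j"] by (simp add: l_def N_def)
    also have "\<dots> \<le> l * (survival k N * l ^ j)" using Suc l_pos by (intro mult_left_mono) auto
    finally show ?case by (simp add: mult_ac)
  qed simp
  have "decay_rate k \<le> l"
  proof (rule root_limit_le[OF lim])
    show "0 \<le> l" using l_pos by simp
    show "0 < 4 * (survival k N / l ^ N)" using pos l_pos by simp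
    fix n assume "N \<le> n"
    then obtain j where n: "n = N + j" by (metis le_Suc_ex)
    have "m n \<le> 4 * (survival k N * l ^ j)" using m_le[of n] up[of j] n by simp
    also have "\<dots> = 4 * (survival k N / l ^ N) * l ^ n" using l_pos by (simp add: n power_add)
    finally show "m n \<le> 4 * (survival k N / l ^ N) * l ^ n" .
  qed
  then show "lower_rate k \<le> 1 - decay_rate k" by (simp add: l_def)
  have "u \<le> decay_rate k"
  proof (cases "u \<le> 0")
    case True
    have "0 \<le> decay_rate k"
      using lim by (rule LIMSEQ_le_const) (simp add: m_def ones_free_measure_def real_root_ge_zero)
    then show ?thesis using True by simp
  next
    case False
    then have u: "0 < u" by simp
    have dn: "survival k N * u ^ j \<le> survival k (N + j)" for j
    proof (induction j)
      case (Suc j)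
      have "u * (survival k N * u ^ j) \<le> u * survival k (N + j)" using Suc u by (intro mult_left_mono) auto
      also have "\<dots> \<le> survival k (N + Suc j)"
        using survival_ratio_bounds(1)[OF k small, of "N + j"] by (simp add: u_def N_def)
      finally show ?case by (simp add: mult_ac)
    qed simp
    show ?thesis
    proof (rule root_limit_ge[OF lim])
      show "0 \<le> u" using u by simp
      show "0 < 1 / 2 * (survival k N / u ^ N)" using pos u by simp
      fix n assume "N \<le> n"
      then obtain j where n: "n = N + j" by (metis le_Suc_ex)
      have "1 / 2 * (survival k N / u ^ N) * u ^ n = 1 / 2 * (survival k N * u ^ j)"
        using u by (simp add: n power_add)
      also have "\<dots> \<le> m n" using m_ge[of n] dn[of j] n by simp
      finally show "1 / 2 * (survival k N / u ^ N) * u ^ n \<le> m n" .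
    qed
  qed
  then show "1 - decay_rate k \<le> upper_rate k" by (simp add: u_def)
qed

section \<open>The limit\<close>

lemma fib_golden_limit: "(\<lambda>n. real (fib n) * golden ^ n * sqrt 5) \<longlonglongrightarrow> 1"
proof -
  have "(1 + sqrt 5) / 2 = 1 + golden" by (simp add: golden_def field_simps)
  also have "\<dots> = 1 / golden"
    using golden_bounds golden_square by (simp add: field_simps power2_eq_square)
  finally have phi: "(1 + sqrt 5) / 2 = 1 / golden" .
  have "real (fib n) / ((1 / golden) ^ n / sqrt 5) = real (fib n) * golden ^ n * sqrt 5" for n
    using golden_bounds by (simp add: power_divide)
  then show ?thesis using fib_asymptotics unfolding phi by simp
qed

lemma ones_length_limit: "(\<lambda>k. ones_length k / golden ^ (2 * k)) \<longlonglongrightarrow> 5 * golden ^ 3"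
proof -
  define g where "g n = real (fib n) * golden ^ n * sqrt 5" for n
  have g: "g \<longlonglongrightarrow> 1" using fib_golden_limit by (simp add: g_def[abs_def])
  have "ones_length k / golden ^ (2 * k) = 5 * golden ^ 3 / (g (k + 1) * g (k + 2))" for k
  proof -
    define a b where "a = real (fib (Suc k))" and "b = real (fib (Suc (Suc k)))"
    have ab: "0 < a" "0 < b"
      using fib_neq_0_nat[of "Suc k"] fib_neq_0_nat[of "Suc (Suc k)"] by (simp_all add: a_def b_def del: fib.simps)
    define w where "w = golden ^ k"
    have w: "0 < w" using golden_bounds by (simp add: w_def)
    have pw: "golden ^ (2 * k) = w * w" "golden ^ Suc k = w * golden"
      "golden ^ Suc (Suc k) = w * golden * golden"
      by (simp_all add: w_def mult_2 power_add)
    have eq: "g (k + 1) * g (k + 2) = 5 * (a * b * (w * w) * golden ^ 3)"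
    proof -
      have "g (k + 1) * g (k + 2) = (sqrt 5 * sqrt 5) * (a * b * (w * w) * golden ^ 3)"
        unfolding g_def by (simp add: pw a_def[symmetric] b_def[symmetric] power3_eq_cube mult_ac del: fib.simps power_Suc)
      then show ?thesis by simp
    qed
    show ?thesis
      unfolding eq ones_length_def a_def[symmetric] b_def[symmetric] pw
      using ab w golden_bounds by simp
  qed
  moreover have "(\<lambda>k. 5 * golden ^ 3 / (g (k + 1) * g (k + 2))) \<longlonglongrightarrow> 5 * golden ^ 3 / (1 * 1)"
    by (intro tendsto_intros LIMSEQ_ignore_initial_segment g) auto
  ultimately show ?thesis by simp
qed

lemma tail_param_limit: "tail_param \<longlonglongrightarrow> golden"
proof -
  define g where "g n = real (fib n) * golden ^ n * sqrt 5" for n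
  have g: "g \<longlonglongrightarrow> 1" using fib_golden_limit by (simp add: g_def[abs_def])
  have "tail_param = (\<lambda>k. golden * (g k / g (k + 1)))"
    using golden_bounds fib_neq_0_nat[of "Suc k"] by (auto simp: tail_param_def g_def)
  moreover have "(\<lambda>k. golden * (g k / g (k + 1))) \<longlonglongrightarrow> golden * (1 / 1)"
    by (intro tendsto_intros LIMSEQ_ignore_initial_segment g) auto
  ultimately show ?thesis by simp
qed

lemma times_ones_length_limit: "(\<lambda>k. 2 * real k * (16 * ones_length k)) \<longlonglongrightarrow> 0"
proof -
  have "norm (golden\<^sup>2) < 1" using golden_bounds by (simp add: golden_square)
  then have "(\<lambda>k. 32 * ((ones_length k / golden ^ (2 * k)) * (real k * (golden\<^sup>2) ^ k)))
      \<longlonglongrightarrow> 32 * ((5 * golden ^ 3) * 0)"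
    by (intro tendsto_mult_left tendsto_mult ones_length_limit powser_times_n_limit_0)
  moreover have "32 * ((ones_length k / golden ^ (2 * k)) * (real k * (golden\<^sup>2) ^ k))
      = 2 * real k * (16 * ones_length k)" for k
    using golden_bounds by (simp add: power_mult)
  ultimately show ?thesis by simp
qed

lemma mixing_error_limit: "mixing_error \<longlonglongrightarrow> 0"
proof -
  let ?q = "\<lambda>k. 1 / (1 - 2 * real k * (16 * ones_length k))"
  have q: "?q \<longlonglongrightarrow> 1 / (1 - 0)" by (intro tendsto_intros times_ones_length_limit) simp
  have "(\<lambda>k. 5 * (?q k - 1) + 16 * (?q k * (65 / 72) ^ k)) \<longlonglongrightarrow> 5 * (1 / (1 - 0) - 1) + 16 * (1 / (1 - 0) * 0)"
    by (intro tendsto_intros q LIMSEQ_power_zero) simp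
  then show ?thesis by (simp add: mixing_error_def[abs_def] Let_def)
qed

text \<open>
  The left-hand side is the product of the length of the cylinder of \<open>k\<close> digits 1, relative to
  \<open>golden ^ (2 * k)\<close>, the probability that the block ends, and the Gauss density at the golden
  point. The right-hand side has the form of the theorem; both equal \<open>5 golden\<^sup>5 / ln 2\<close>.
\<close>
lemma rate_constant:
  "5 * golden ^ 3 * (1 - 1 / (2 + golden)) / ((1 + golden) * ln 2)
    = golden ^ 3 * (1 + golden\<^sup>2)\<^sup>2 / ln 2"
proof -
  have "(2 + golden) * golden\<^sup>2 = 1"
    unfolding golden_square using golden_square by (simp add: algebra_simps power2_eq_square)
  then have c: "1 / (2 + golden) = golden\<^sup>2" using golden_bounds by (simp add: divide_simps mult.commute)
  have "(1 + golden\<^sup>2)\<^sup>2 = (2 - golden)\<^sup>2" by (simp add: golden_square)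
  also have "\<dots> = 4 - 4 * golden + golden\<^sup>2" by (simp add: power2_eq_square algebra_simps)
  also have "\<dots> = 5 * golden\<^sup>2" by (simp add: golden_square)
  finally have five: "(1 + golden\<^sup>2)\<^sup>2 = 5 * golden\<^sup>2" .
  have "5 * golden ^ 3 * (1 - 1 / (2 + golden)) / ((1 + golden) * ln 2)
      = 5 * golden ^ 3 * golden * (1 / (1 + golden)) / ln 2"
    by (simp add: c golden_square)
  also have "\<dots> = golden ^ 3 * (1 + golden\<^sup>2)\<^sup>2 / ln 2"
    unfolding golden_fixed five by (simp add: power2_eq_square)
  finally show ?thesis .
qed

lemma rates_limit:
  "(\<lambda>k. lower_rate k / golden ^ (2 * k)) \<longlonglongrightarrow> golden ^ 3 * (1 + golden\<^sup>2)\<^sup>2 / ln 2"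
  "(\<lambda>k. upper_rate k / golden ^ (2 * k)) \<longlonglongrightarrow> golden ^ 3 * (1 + golden\<^sup>2)\<^sup>2 / ln 2"
proof -
  have gk: "(\<lambda>k. golden ^ k) \<longlonglongrightarrow> 0" using golden_bounds by (intro LIMSEQ_power_zero) simp
  have nz: "2 + golden \<noteq> 0" "(1 + golden) * ln 2 \<noteq> 0" using golden_bounds by auto
  have "(\<lambda>k. (ones_length k / golden ^ (2 * k)) * (1 - 1 / (2 + tail_param k) - 2 * mixing_error k)
      / ((1 + golden + golden ^ k) * ln 2))
    \<longlonglongrightarrow> 5 * golden ^ 3 * (1 - 1 / (2 + golden) - 2 * 0) / ((1 + golden + 0) * ln 2)"
    using nz by (intro tendsto_intros ones_length_limit tail_param_limit mixing_error_limit gk) simp_all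
  then show "(\<lambda>k. lower_rate k / golden ^ (2 * k)) \<longlonglongrightarrow> golden ^ 3 * (1 + golden\<^sup>2)\<^sup>2 / ln 2"
    unfolding rate_constant[symmetric] by (simp add: lower_rate_def mult_ac)
  have "(\<lambda>k. (ones_length k / golden ^ (2 * k)) * (1 - 1 / (2 + tail_param k) + 2 * mixing_error k)
      / ((1 + golden - golden ^ k) * ln 2))
    \<longlonglongrightarrow> 5 * golden ^ 3 * (1 - 1 / (2 + golden) + 2 * 0) / ((1 + golden - 0) * ln 2)"
    using nz by (intro tendsto_intros ones_length_limit tail_param_limit mixing_error_limit gk) simp_all
  then show "(\<lambda>k. upper_rate k / golden ^ (2 * k)) \<longlonglongrightarrow> golden ^ 3 * (1 + golden\<^sup>2)\<^sup>2 / ln 2"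
    unfolding rate_constant[symmetric] by (simp add: upper_rate_def mult_ac)
qed

theorem mainTheorem3:
  fixes z :: real
  assumes "z = (sqrt 5 - 1) / 2"
  shows "(\<forall>k\<ge>1. convergent (\<lambda>n. root n (ones_free_measure k n))) \<and>
    (\<lambda>k. (1 - decay_rate k) / z ^ (2 * k)) \<longlonglongrightarrow> z ^ 3 * (1 + z\<^sup>2)\<^sup>2 / ln 2"
proof (intro conjI allI impI)
  fix k :: nat assume "1 \<le> k"
  then show "convergent (\<lambda>n. root n (ones_free_measure k n))" by (rule convergent_ones_free_measure)
next
  have z: "z = golden" using assms by (simp add: golden_def)
  have "\<forall>\<^sub>F k in sequentially. 2 * real k * (16 * ones_length k) < 1 / 2"
    by (rule order_tendstoD(2)[OF times_ones_length_limit]) simp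
  then have ev: "\<forall>\<^sub>F k in sequentially. 1 \<le> k \<and> 2 * real k * (16 * ones_length k) \<le> 1 / 2"
    using eventually_ge_at_top[of 1] by eventually_elim simp
  have "0 \<le> golden ^ j" for j using golden_bounds by simp
  note bound = divide_right_mono[OF _ this]
  show "(\<lambda>k. (1 - decay_rate k) / z ^ (2 * k)) \<longlonglongrightarrow> z ^ 3 * (1 + z\<^sup>2)\<^sup>2 / ln 2"
    unfolding z
  proof (rule tendsto_sandwich[OF _ _ rates_limit])
    show "\<forall>\<^sub>F k in sequentially. lower_rate k / golden ^ (2 * k) \<le> (1 - decay_rate k) / golden ^ (2 * k)"
      using ev by eventually_elim (intro bound decay_rate_bounds, auto)
    show "\<forall>\<^sub>F k in sequentially. (1 - decay_rate k) / golden ^ (2 * k) \<le> upper_rate k / golden ^ (2 * k)"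
      using ev by eventually_elim (intro bound decay_rate_bounds, auto)
  qed
qed

end
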